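(* $T^\dagger=\{t\in T\mid\exists i\in I:\ t=e_i\circ t\circ e_i\}$ is a subalgebra of $T=\operatorname{End}_{\mathcal{A}}(M)$ with idempotent local units. In particular, $T^\dagger$ is a firm $k$-algebra. Moreover $\operatorname{colim}\underline{T}=(T^\dagger,\rho)$, with $$\rho_i:\ T_i\to T^\dagger,\qquad \rho_i(t_i)=\mu_i\circ t_i\circ\nu_i\qquad(i\in I).$$
   Context: $k$ is a commutative ring. A (not necessarily unital) $k$-algebra $R$ is firm if the multiplication $R\otimes_RR\to R$ is an isomorphism; $\mathcal{F}_k$ is the category of firm $k$-algebras (morphisms are multiplicative $k$-linear maps, not required to preserve units). A $k$-algebra $R$ has idempotent local units if there is a set of idempotents in $R$ such that for every finite $F\subset R$ some idempotent $e$ in the set satisfies $eb=be=b$ for all $b\in F$. (A subalgebra is not required to contain the unit.) Let $(I,\le)$ be a directed partially ordered set and $\mathcal{Z}$ the associated category: objects are the elements of $I$, with exactly one morphism $a_{ji}:i\to j$ if $i\le j$ and none otherwise. For a category $\mathcal{A}$, $\mathcal{A}^s$ has the same objects, and a morphism $M\to N$ in $\mathcal{A}^s$ is a pair $(\mu,\nu)$ with $\mu:M\to N$, $\nu:N\to M$ in $\mathcal{A}$ and $\nu\circ\mu=\mathrm{id}_M$. A split direct system with values in $\mathcal{A}$ is a functor $\underline{M}^s:\mathcal{Z}\to\mathcal{A}^s$, written $\underline{M}^s(i)=M_i$, $\underline{M}^s(a_{ji})=(\mu_{ji},\nu_{ij})$ (so $\mu_{ji}:M_i\to M_j$, $\nu_{ij}:M_j\to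 M_i$); $\underline{M}:\mathcal{Z}\to\mathcal{A}$ is the underlying direct system $i\mapsto M_i$, $a_{ji}\mapsto\mu_{ji}$. Setting: $\mathcal{A}$ is a $k$-linear category, $\underline{M}^s:\mathcal{Z}\to\mathcal{A}^s$ is a split direct system, $\operatorname{colim}\underline{M}=(M,\mu)$ exists with cocone maps $\mu_i:M_i\to M$, and $\nu_i:M\to M_i$ are the unique morphisms with $\nu_i\circ\mu_i=\mathrm{id}_{M_i}$ and $\nu_i=\nu_{ij}\circ\nu_j$ for $i\le j$. (It is also assumed that there is a functor $\omega:\mathcal{A}\to\mathcal{M}_A$ preserving colimits, $\mathcal{M}_A$ being the category of right modules over a unital $k$-algebra $A$, such that each $\omega(M_i)$ is finitely generated projective over $A$.) Put $T=\operatorname{End}_{\mathcal{A}}(M)$, $T_i=\operatorname{End}_{\mathcal{A}}(M_i)$ and $e_i=\mu_i\circ\nu_i\in T$, an idempotent. $\underline{T}:\mathcal{Z}\to\mathcal{F}_k$ is the direct system $\underline{T}(i)=T_i$, $\underline{T}(a_{ji})=\rho_{ji}:T_i\to T_j$, $\rho_{ji}(t_i)=\mu_{ji}\circ t_i\circ\nu_{ij}$. *)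

theory Defs
  imports Complex_Main "HOL-Algebra.Module" "HOL-Algebra.AbelCoset"
begin

section \<open>Categories, functors, colimits\<close>

text \<open>Hom-sets need not be disjoint, so composition and the arrow part of a functor take the
  objects as arguments: \<open>Comp C X Y Z g f\<close> is \<open>g \<circ> f\<close> for \<open>f : X \<rightarrow> Y\<close> and \<open>g : Y \<rightarrow> Z\<close>.\<close>

record ('o, 'm) category =
  Obj :: "'o set"
  Hom :: "'o \<Rightarrow> 'o \<Rightarrow> 'm set"
  Comp :: "'o \<Rightarrow> 'o \<Rightarrow> 'o \<Rightarrow> 'm \<Rightarrow> 'm \<Rightarrow> 'm"
  Ident :: "'o \<Rightarrow> 'm"

locale category =
  fixes C :: "('o, 'm, 'z) category_scheme"
  assumes Ident_in_Hom: "X \<in> Obj C \<Longrightarrow> Ident C X \<in> Hom C X X"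
    and Comp_in_Hom:
      "\<lbrakk>X \<in> Obj C; Y \<in> Obj C; Z \<in> Obj C; f \<in> Hom C X Y; g \<in> Hom C Y Z\<rbrakk>
       \<Longrightarrow> Comp C X Y Z g f \<in> Hom C X Z"
    and Comp_assoc:
      "\<lbrakk>W \<in> Obj C; X \<in> Obj C; Y \<in> Obj C; Z \<in> Obj C;
        f \<in> Hom C W X; g \<in> Hom C X Y; h \<in> Hom C Y Z\<rbrakk>
       \<Longrightarrow> Comp C W X Z (Comp C X Y Z h g) f = Comp C W Y Z h (Comp C W X Y g f)"
    and Comp_Ident_left:
      "\<lbrakk>X \<in> Obj C; Y \<in> Obj C; f \<in> Hom C X Y\<rbrakk> \<Longrightarrow> Comp C X Y Y (Ident C Y) f = f"
    and Comp_Ident_right: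
      "\<lbrakk>X \<in> Obj C; Y \<in> Obj C; f \<in> Hom C X Y\<rbrakk> \<Longrightarrow> Comp C X X Y f (Ident C X) = f"

record ('o, 'm, 'p, 'n) functor_data =
  ob_map :: "'o \<Rightarrow> 'p"
  ar_map :: "'o \<Rightarrow> 'o \<Rightarrow> 'm \<Rightarrow> 'n"

definition is_functor ::
  "('o, 'm, 'z) category_scheme \<Rightarrow> ('p, 'n, 'w) category_scheme \<Rightarrow> ('o, 'm, 'p, 'n) functor_data \<Rightarrow> bool"
  where "is_functor C D F \<longleftrightarrow>
    (\<forall>X\<in>Obj C. ob_map F X \<in> Obj D) \<and>
    (\<forall>X\<in>Obj C. \<forall>Y\<in>Obj C. \<forall>f\<in>Hom C X Y. ar_map F X Y f \<in> Hom D (ob_map F X) (ob_map F Y)) \<and>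
    (\<forall>X\<in>Obj C. ar_map F X X (Ident C X) = Ident D (ob_map F X)) \<and>
    (\<forall>X\<in>Obj C. \<forall>Y\<in>Obj C. \<forall>Z\<in>Obj C. \<forall>f\<in>Hom C X Y. \<forall>g\<in>Hom C Y Z.
       ar_map F X Z (Comp C X Y Z g f) =
       Comp D (ob_map F X) (ob_map F Y) (ob_map F Z) (ar_map F Y Z g) (ar_map F X Y f))"

definition functor_comp ::
  "('p, 'n, 'q, 'l) functor_data \<Rightarrow> ('o, 'm, 'p, 'n) functor_data \<Rightarrow> ('o, 'm, 'q, 'l) functor_data"
  where "functor_comp G F =
    \<lparr>ob_map = (\<lambda>X. ob_map G (ob_map F X)),
     ar_map = (\<lambda>X Y f. ar_map G (ob_map F X) (ob_map F Y) (ar_map F X Y f))\<rparr>"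

definition is_cocone ::
  "('j, 'a, 'z) category_scheme \<Rightarrow> ('o, 'm, 'w) category_scheme \<Rightarrow> ('j, 'a, 'o, 'm) functor_data
   \<Rightarrow> 'o \<Rightarrow> ('j \<Rightarrow> 'm) \<Rightarrow> bool"
  where "is_cocone J C F L c \<longleftrightarrow>
    L \<in> Obj C \<and>
    (\<forall>i\<in>Obj J. c i \<in> Hom C (ob_map F i) L) \<and>
    (\<forall>i\<in>Obj J. \<forall>j\<in>Obj J. \<forall>a\<in>Hom J i j.
       Comp C (ob_map F i) (ob_map F j) L (c j) (ar_map F i j a) = c i)"

definition is_colimit ::
  "('j, 'a, 'z) category_scheme \<Rightarrow> ('o, 'm, 'w) category_scheme \<Rightarrow> ('j, 'a, 'o, 'm) functor_data
   \<Rightarrow> 'o \<Rightarrow> ('j \<Rightarrow> 'm) \<Rightarrow> bool"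
  where "is_colimit J C F L c \<longleftrightarrow>
    is_functor J C F \<and> is_cocone J C F L c \<and>
    (\<forall>N d. is_cocone J C F N d \<longrightarrow>
       (\<exists>!h. h \<in> Hom C L N \<and> (\<forall>i\<in>Obj J. Comp C (ob_map F i) L N h (c i) = d i)))"

definition preserves_colimits_of_shape ::
  "('j, 'a, 'z) category_scheme \<Rightarrow> ('o, 'm, 'w) category_scheme \<Rightarrow> ('p, 'n, 'v) category_scheme
   \<Rightarrow> ('o, 'm, 'p, 'n) functor_data \<Rightarrow> bool"
  where "preserves_colimits_of_shape J C D G \<longleftrightarrow>
    (\<forall>F L c. is_colimit J C F L c \<longrightarrow>
       is_colimit J D (functor_comp G F) (ob_map G L)
         (\<lambda>i. ar_map G (ob_map F i) L (c i)))"


section \<open>Linear categories and endomorphism algebras\<close>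

record ('k, 'o, 'm) lin_category = "('o, 'm) category" +
  hom_zero :: "'o \<Rightarrow> 'o \<Rightarrow> 'm"
  hom_add :: "'o \<Rightarrow> 'o \<Rightarrow> 'm \<Rightarrow> 'm \<Rightarrow> 'm"
  hom_smult :: "'o \<Rightarrow> 'o \<Rightarrow> 'k \<Rightarrow> 'm \<Rightarrow> 'm"

definition hom_module :: "('k, 'o, 'm) lin_category \<Rightarrow> 'o \<Rightarrow> 'o \<Rightarrow> ('k, 'm) module"
  where "hom_module C X Y =
    \<lparr>carrier = Hom C X Y, mult = undefined, one = undefined,
     zero = hom_zero C X Y, add = hom_add C X Y, smult = hom_smult C X Y\<rparr>"

locale linear_category = K?: cring K + category C
  for K :: "('k, 'z) ring_scheme" (structure) and C :: "('k, 'o, 'm) lin_category" +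
  assumes module_Hom: "\<lbrakk>X \<in> Obj C; Y \<in> Obj C\<rbrakk> \<Longrightarrow> module K (hom_module C X Y)"
    and Comp_add_left:
      "\<lbrakk>X \<in> Obj C; Y \<in> Obj C; Z \<in> Obj C; f \<in> Hom C X Y; g \<in> Hom C Y Z; g' \<in> Hom C Y Z\<rbrakk>
       \<Longrightarrow> Comp C X Y Z (hom_add C Y Z g g') f =
           hom_add C X Z (Comp C X Y Z g f) (Comp C X Y Z g' f)"
    and Comp_add_right:
      "\<lbrakk>X \<in> Obj C; Y \<in> Obj C; Z \<in> Obj C; f \<in> Hom C X Y; f' \<in> Hom C X Y; g \<in> Hom C Y Z\<rbrakk>
       \<Longrightarrow> Comp C X Y Z g (hom_add C X Y f f') =
           hom_add C X Z (Comp C X Y Z g f) (Comp C X Y Z g f')"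
    and Comp_smult_left:
      "\<lbrakk>X \<in> Obj C; Y \<in> Obj C; Z \<in> Obj C; c \<in> carrier K; f \<in> Hom C X Y; g \<in> Hom C Y Z\<rbrakk>
       \<Longrightarrow> Comp C X Y Z (hom_smult C Y Z c g) f = hom_smult C X Z c (Comp C X Y Z g f)"
    and Comp_smult_right:
      "\<lbrakk>X \<in> Obj C; Y \<in> Obj C; Z \<in> Obj C; c \<in> carrier K; f \<in> Hom C X Y; g \<in> Hom C Y Z\<rbrakk>
       \<Longrightarrow> Comp C X Y Z g (hom_smult C X Y c f) = hom_smult C X Z c (Comp C X Y Z g f)"

definition End_alg :: "('k, 'o, 'm) lin_category \<Rightarrow> 'o \<Rightarrow> ('k, 'm) module"
  where "End_alg C X =
    \<lparr>carrier = Hom C X X, mult = Comp C X X X, one = Ident C X,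
     zero = hom_zero C X X, add = hom_add C X X, smult = hom_smult C X X\<rparr>"


section \<open>Algebras without unit\<close>

text \<open>The library's \<open>module\<close> record carries \<open>mult\<close> and \<open>one\<close> fields, of which the locale \<open>module\<close>
  uses neither. For a not necessarily unital algebra \<open>mult\<close> is the multiplication and \<open>one\<close> is
  meaningless. (The library's \<open>algebra\<close> is commutative and unital.)\<close>

locale k_algebra = module K R
  for K :: "('k, 'z) ring_scheme" (structure) and R :: "('k, 'r, 'w) module_scheme" (structure) +
  assumes m_closed: "\<lbrakk>x \<in> carrier R; y \<in> carrier R\<rbrakk> \<Longrightarrow> x \<otimes>\<^bsub>R\<^esub> y \<in> carrier R"
    and m_assoc: "\<lbrakk>x \<in> carrier R; y \<in> carrier R; z \<in> carrier R\<rbrakk>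
       \<Longrightarrow> (x \<otimes>\<^bsub>R\<^esub> y) \<otimes>\<^bsub>R\<^esub> z = x \<otimes>\<^bsub>R\<^esub> (y \<otimes>\<^bsub>R\<^esub> z)"
    and m_l_distr: "\<lbrakk>x \<in> carrier R; y \<in> carrier R; z \<in> carrier R\<rbrakk>
       \<Longrightarrow> (x \<oplus>\<^bsub>R\<^esub> y) \<otimes>\<^bsub>R\<^esub> z = x \<otimes>\<^bsub>R\<^esub> z \<oplus>\<^bsub>R\<^esub> y \<otimes>\<^bsub>R\<^esub> z"
    and m_r_distr: "\<lbrakk>x \<in> carrier R; y \<in> carrier R; z \<in> carrier R\<rbrakk>
       \<Longrightarrow> z \<otimes>\<^bsub>R\<^esub> (x \<oplus>\<^bsub>R\<^esub> y) = z \<otimes>\<^bsub>R\<^esub> x \<oplus>\<^bsub>R\<^esub> z \<otimes>\<^bsub>R\<^esub> y"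
    and smult_m_left: "\<lbrakk>c \<in> carrier K; x \<in> carrier R; y \<in> carrier R\<rbrakk>
       \<Longrightarrow> (c \<odot>\<^bsub>R\<^esub> x) \<otimes>\<^bsub>R\<^esub> y = c \<odot>\<^bsub>R\<^esub> (x \<otimes>\<^bsub>R\<^esub> y)"
    and smult_m_right: "\<lbrakk>c \<in> carrier K; x \<in> carrier R; y \<in> carrier R\<rbrakk>
       \<Longrightarrow> x \<otimes>\<^bsub>R\<^esub> (c \<odot>\<^bsub>R\<^esub> y) = c \<odot>\<^bsub>R\<^esub> (x \<otimes>\<^bsub>R\<^esub> y)"

locale unital_k_algebra = k_algebra K R + ring R
  for K :: "('k, 'z) ring_scheme" (structure) and R :: "('k, 'r, 'w) module_scheme" (structure)

definition k_subalgebra ::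
  "('k, 'z) ring_scheme \<Rightarrow> 'r set \<Rightarrow> ('k, 'r, 'w) module_scheme \<Rightarrow> bool"
  where "k_subalgebra K S R \<longleftrightarrow>
    submodule S K R \<and> (\<forall>x\<in>S. \<forall>y\<in>S. x \<otimes>\<^bsub>R\<^esub> y \<in> S)"

definition idempotent_local_units :: "('k, 'r, 'w) module_scheme \<Rightarrow> bool"
  where "idempotent_local_units R \<longleftrightarrow>
    (\<exists>E\<subseteq>carrier R. (\<forall>e\<in>E. e \<otimes>\<^bsub>R\<^esub> e = e) \<and>
       (\<forall>F. finite F \<and> F \<subseteq> carrier R \<longrightarrow>
          (\<exists>e\<in>E. \<forall>b\<in>F. e \<otimes>\<^bsub>R\<^esub> b = b \<and> b \<otimes>\<^bsub>R\<^esub> e = b)))"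

text \<open>Maps between carriers are taken extensional (\<open>undefined\<close> off the carrier), so that equality
  of morphisms is equality of functions. \<open>lin_hom\<close> only refers to addition and \<open>smult\<close>; it is used
  for modules over a commutative ring as well as for right modules (see below).\<close>

definition lin_hom ::
  "('k, 'z) ring_scheme \<Rightarrow> ('k, 'r, 'v) module_scheme \<Rightarrow> ('k, 's, 'w) module_scheme \<Rightarrow> ('r \<Rightarrow> 's) set"
  where "lin_hom K X Y =
    {f \<in> carrier X \<rightarrow>\<^sub>E carrier Y.
       (\<forall>x\<in>carrier X. \<forall>y\<in>carrier X. f (x \<oplus>\<^bsub>X\<^esub> y) = f x \<oplus>\<^bsub>Y\<^esub> f y) \<and>
       (\<forall>c\<in>carrier K. \<forall>x\<in>carrier X. f (c \<odot>\<^bsub>X\<^esub> x) = c \<odot>\<^bsub>Y\<^esub> f x)}"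

definition alg_hom ::
  "('k, 'z) ring_scheme \<Rightarrow> ('k, 'r, 'v) module_scheme \<Rightarrow> ('k, 's, 'w) module_scheme \<Rightarrow> ('r \<Rightarrow> 's) set"
  where "alg_hom K X Y =
    {f \<in> lin_hom K X Y. \<forall>x\<in>carrier X. \<forall>y\<in>carrier X. f (x \<otimes>\<^bsub>X\<^esub> y) = f x \<otimes>\<^bsub>Y\<^esub> f y}"


section \<open>The tensor square over a nonunital algebra; firm algebras\<close>

definition free_module :: "('k, 'z) ring_scheme \<Rightarrow> 's set \<Rightarrow> ('k, 's \<Rightarrow> 'k) module"
  where "free_module K S =
    \<lparr>carrier = {f. (\<forall>s\<in>S. f s \<in> carrier K) \<and> (\<forall>s. s \<notin> S \<longrightarrow> f s = \<zero>\<^bsub>K\<^esub>) \<and>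
                   finite {s. f s \<noteq> \<zero>\<^bsub>K\<^esub>}},
     mult = undefined, one = undefined,
     zero = (\<lambda>s. \<zero>\<^bsub>K\<^esub>), add = (\<lambda>f g s. f s \<oplus>\<^bsub>K\<^esub> g s), smult = (\<lambda>c f s. c \<otimes>\<^bsub>K\<^esub> f s)\<rparr>"

definition quotient_module ::
  "('k, 'z) ring_scheme \<Rightarrow> ('k, 'x, 'w) module_scheme \<Rightarrow> 'x set \<Rightarrow> ('k, 'x set) module"
  where "quotient_module K F N =
    \<lparr>carrier = a_rcosets\<^bsub>F\<^esub> N, mult = undefined, one = undefined,
     zero = N, add = set_add F, smult = (\<lambda>c X. \<Union>x\<in>X. N +>\<^bsub>F\<^esub> (c \<odot>\<^bsub>F\<^esub> x))\<rparr>"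

text \<open>\<open>R \<otimes>\<^sub>R R\<close> is the free \<open>K\<close>-module on \<open>R \<times> R\<close> modulo the relations of \<open>K\<close>-bilinearity and
  \<open>x r \<otimes> y = x \<otimes> r y\<close>. Since \<open>R\<close> need not have a unit, \<open>K\<close>-balancedness is not a consequence of
  \<open>R\<close>-balancedness and is imposed separately.\<close>

definition basis_elt :: "('k, 'z) ring_scheme \<Rightarrow> 's \<Rightarrow> 's \<Rightarrow> 'k"
  where "basis_elt K s = (\<lambda>t. if t = s then \<one>\<^bsub>K\<^esub> else \<zero>\<^bsub>K\<^esub>)"

definition tensor_relations ::
  "('k, 'z) ring_scheme \<Rightarrow> ('k, 'r, 'w) module_scheme \<Rightarrow> ('r \<times> 'r \<Rightarrow> 'k) set"
  where "tensor_relations K R =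
    (let F = free_module K (carrier R \<times> carrier R); d = (\<lambda>x y. basis_elt K (x, y)) in
      {d (x \<oplus>\<^bsub>R\<^esub> x') y \<ominus>\<^bsub>F\<^esub> (d x y \<oplus>\<^bsub>F\<^esub> d x' y) | x x' y.
         x \<in> carrier R \<and> x' \<in> carrier R \<and> y \<in> carrier R} \<union>
      {d x (y \<oplus>\<^bsub>R\<^esub> y') \<ominus>\<^bsub>F\<^esub> (d x y \<oplus>\<^bsub>F\<^esub> d x y') | x y y'.
         x \<in> carrier R \<and> y \<in> carrier R \<and> y' \<in> carrier R} \<union>
      {d (c \<odot>\<^bsub>R\<^esub> x) y \<ominus>\<^bsub>F\<^esub> c \<odot>\<^bsub>F\<^esub> d x y | c x y.
         c \<in> carrier K \<and> x \<in> carrier R \<and> y \<in> carrier R} \<union>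
      {d x (c \<odot>\<^bsub>R\<^esub> y) \<ominus>\<^bsub>F\<^esub> c \<odot>\<^bsub>F\<^esub> d x y | c x y.
         c \<in> carrier K \<and> x \<in> carrier R \<and> y \<in> carrier R} \<union>
      {d (x \<otimes>\<^bsub>R\<^esub> r) y \<ominus>\<^bsub>F\<^esub> d x (r \<otimes>\<^bsub>R\<^esub> y) | x r y.
         x \<in> carrier R \<and> r \<in> carrier R \<and> y \<in> carrier R})"

definition tensor_square ::
  "('k, 'z) ring_scheme \<Rightarrow> ('k, 'r, 'w) module_scheme \<Rightarrow> ('k, ('r \<times> 'r \<Rightarrow> 'k) set) module"
  where "tensor_square K R =
    (let F = free_module K (carrier R \<times> carrier R) in
     quotient_module K F ((\<lambda>N. submodule N K F) hull tensor_relations K R))"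

text \<open>On the free module the multiplication sends \<open>\<Sum> c (x, y)\<close> to \<open>\<Sum> c x y\<close>; it is constant on
  cosets, and \<open>mult_map\<close> is the induced map on the quotient.\<close>

definition free_mult_map ::
  "('k, 'z) ring_scheme \<Rightarrow> ('k, 'r, 'w) module_scheme \<Rightarrow> ('r \<times> 'r \<Rightarrow> 'k) \<Rightarrow> 'r"
  where "free_mult_map K R f =
    (\<Oplus>\<^bsub>R\<^esub>p\<in>{p. f p \<noteq> \<zero>\<^bsub>K\<^esub>}. f p \<odot>\<^bsub>R\<^esub> (fst p \<otimes>\<^bsub>R\<^esub> snd p))"

definition mult_map ::
  "('k, 'z) ring_scheme \<Rightarrow> ('k, 'r, 'w) module_scheme \<Rightarrow> ('r \<times> 'r \<Rightarrow> 'k) set \<Rightarrow> 'r"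
  where "mult_map K R = (\<lambda>X\<in>carrier (tensor_square K R). the_elem (free_mult_map K R ` X))"

definition firm :: "('k, 'z) ring_scheme \<Rightarrow> ('k, 'r, 'w) module_scheme \<Rightarrow> bool"
  where "firm K R \<longleftrightarrow>
    k_algebra K R \<and>
    mult_map K R \<in> lin_hom K (tensor_square K R) R \<and>
    bij_betw (mult_map K R) (carrier (tensor_square K R)) (carrier R)"

text \<open>The category of firm \<open>K\<close>-algebras whose underlying sets are subsets of a given type.\<close>

definition firm_cat :: "('k, 'z) ring_scheme \<Rightarrow> (('k, 'r) module, 'r \<Rightarrow> 'r) category"
  where "firm_cat K =
    \<lparr>Obj = {R. firm K R}, Hom = alg_hom K,
     Comp = (\<lambda>X Y Z g f. compose (carrier X) g f), Ident = (\<lambda>X. \<lambda>x\<in>carrier X. x)\<rparr>"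


section \<open>Right modules\<close>

text \<open>For a right module, \<open>a \<odot> x\<close> stands for \<open>x \<cdot> a\<close>; hence the order of \<open>a\<close> and \<open>b\<close> in
  \<open>r_smult_assoc\<close>.\<close>

locale right_module = A?: ring A + N?: abelian_group N
  for A :: "('a, 'z) ring_scheme" (structure) and N :: "('a, 'v, 'w) module_scheme" (structure) +
  assumes r_smult_closed: "\<lbrakk>a \<in> carrier A; x \<in> carrier N\<rbrakk> \<Longrightarrow> a \<odot>\<^bsub>N\<^esub> x \<in> carrier N"
    and r_smult_distr_scalar: "\<lbrakk>a \<in> carrier A; b \<in> carrier A; x \<in> carrier N\<rbrakk>
       \<Longrightarrow> (a \<oplus>\<^bsub>A\<^esub> b) \<odot>\<^bsub>N\<^esub> x = a \<odot>\<^bsub>N\<^esub> x \<oplus>\<^bsub>N\<^esub> b \<odot>\<^bsub>N\<^esub> x"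
    and r_smult_distr: "\<lbrakk>a \<in> carrier A; x \<in> carrier N; y \<in> carrier N\<rbrakk>
       \<Longrightarrow> a \<odot>\<^bsub>N\<^esub> (x \<oplus>\<^bsub>N\<^esub> y) = a \<odot>\<^bsub>N\<^esub> x \<oplus>\<^bsub>N\<^esub> a \<odot>\<^bsub>N\<^esub> y"
    and r_smult_assoc: "\<lbrakk>a \<in> carrier A; b \<in> carrier A; x \<in> carrier N\<rbrakk>
       \<Longrightarrow> (a \<otimes>\<^bsub>A\<^esub> b) \<odot>\<^bsub>N\<^esub> x = b \<odot>\<^bsub>N\<^esub> (a \<odot>\<^bsub>N\<^esub> x)"
    and r_smult_one: "x \<in> carrier N \<Longrightarrow> \<one>\<^bsub>A\<^esub> \<odot>\<^bsub>N\<^esub> x = x"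

definition right_module_cat :: "('a, 'z) ring_scheme \<Rightarrow> (('a, 'v) module, 'v \<Rightarrow> 'v) category"
  where "right_module_cat A =
    \<lparr>Obj = {N. right_module A N}, Hom = lin_hom A,
     Comp = (\<lambda>X Y Z g f. compose (carrier X) g f), Ident = (\<lambda>X. \<lambda>x\<in>carrier X. x)\<rparr>"

definition finitely_generated :: "('a, 'z) ring_scheme \<Rightarrow> ('a, 'v, 'w) module_scheme \<Rightarrow> bool"
  where "finitely_generated A P \<longleftrightarrow>
    (\<exists>S\<subseteq>carrier P. finite S \<and>
       (\<forall>x\<in>carrier P. \<exists>c\<in>S \<rightarrow> carrier A. x = (\<Oplus>\<^bsub>P\<^esub>s\<in>S. c s \<odot>\<^bsub>P\<^esub> s)))"

text \<open>Lifting along surjections. The type of \<open>N\<close> is large enough to contain the free module on the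
  underlying set of \<open>P\<close>, and \<open>Q = P\<close> is allowed, so the restriction to test modules over these
  types does not change the notion.\<close>

definition projective :: "('a, 'z) ring_scheme \<Rightarrow> ('a, 'v) module \<Rightarrow> bool"
  where "projective A P \<longleftrightarrow>
    (\<forall>(N :: ('a, 'v \<Rightarrow> 'a) module) (Q :: ('a, 'v) module) g f.
       right_module A N \<and> right_module A Q \<and>
       g \<in> lin_hom A N Q \<and> g ` carrier N = carrier Q \<and> f \<in> lin_hom A P Q \<longrightarrow>
       (\<exists>h\<in>lin_hom A P N. \<forall>x\<in>carrier P. g (h x) = f x))"


section \<open>Split direct systems\<close>

definition directed_poset :: "'i set \<Rightarrow> 'i rel \<Rightarrow> bool"
  where "directed_poset I r \<longleftrightarrow>
    partial_order_on I r \<and> I \<noteq> {} \<and> (\<forall>i\<in>I. \<forall>j\<in>I. \<exists>k\<in>I. (i, k) \<in> r \<and> (j, k) \<in> r)"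

text \<open>\<open>(i, j) \<in> r\<close> means \<open>i \<le> j\<close>, and the unique arrow from \<open>i\<close> to \<open>j\<close> is the pair \<open>(i, j)\<close>.\<close>

definition poset_cat :: "'i set \<Rightarrow> 'i rel \<Rightarrow> ('i, 'i \<times> 'i) category"
  where "poset_cat I r =
    \<lparr>Obj = I, Hom = (\<lambda>i j. {(i, j)} \<inter> r), Comp = (\<lambda>i j k b a. (i, k)), Ident = (\<lambda>i. (i, i))\<rparr>"

definition split_cat :: "('o, 'm, 'z) category_scheme \<Rightarrow> ('o, 'm \<times> 'm) category"
  where "split_cat C =
    \<lparr>Obj = Obj C,
     Hom = (\<lambda>X Y. {(\<mu>, \<nu>). \<mu> \<in> Hom C X Y \<and> \<nu> \<in> Hom C Y X \<and> Comp C X Y X \<nu> \<mu> = Ident C X}),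
     Comp = (\<lambda>X Y Z q p. (Comp C X Y Z (fst q) (fst p), Comp C Z Y X (snd p) (snd q))),
     Ident = (\<lambda>X. (Ident C X, Ident C X))\<rparr>"

definition underlying_system ::
  "('i, 'i \<times> 'i, 'o, 'm \<times> 'm) functor_data \<Rightarrow> ('i, 'i \<times> 'i, 'o, 'm) functor_data"
  where "underlying_system Ms =
    \<lparr>ob_map = ob_map Ms, ar_map = (\<lambda>i j a. fst (ar_map Ms i j a))\<rparr>"

text \<open>\<open>sys_mu Ms j i\<close> is \<open>\<mu>\<^sub>j\<^sub>i : M\<^sub>i \<rightarrow> M\<^sub>j\<close> and \<open>sys_nu Ms i j\<close> is \<open>\<nu>\<^sub>i\<^sub>j : M\<^sub>j \<rightarrow> M\<^sub>i\<close>, for \<open>i \<le> j\<close>.\<close>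

definition sys_mu :: "('i, 'i \<times> 'i, 'o, 'm \<times> 'm) functor_data \<Rightarrow> 'i \<Rightarrow> 'i \<Rightarrow> 'm"
  where "sys_mu Ms j i = fst (ar_map Ms i j (i, j))"

definition sys_nu :: "('i, 'i \<times> 'i, 'o, 'm \<times> 'm) functor_data \<Rightarrow> 'i \<Rightarrow> 'i \<Rightarrow> 'm"
  where "sys_nu Ms i j = snd (ar_map Ms i j (i, j))"

definition conj_map :: "('k, 'o, 'm) lin_category \<Rightarrow> 'o \<Rightarrow> 'o \<Rightarrow> 'm \<Rightarrow> 'm \<Rightarrow> 'm \<Rightarrow> 'm"
  where "conj_map C X Y \<mu> \<nu> = (\<lambda>t\<in>Hom C X X. Comp C Y X Y \<mu> (Comp C Y X X t \<nu>))"

text \<open>The direct system \<open>i \<mapsto> T\<^sub>i = End(M\<^sub>i)\<close>, with \<open>\<rho>\<^sub>j\<^sub>i(t) = \<mu>\<^sub>j\<^sub>i \<circ> t \<circ> \<nu>\<^sub>i\<^sub>j\<close>.\<close>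

definition End_system ::
  "('k, 'o, 'm) lin_category \<Rightarrow> ('i, 'i \<times> 'i, 'o, 'm \<times> 'm) functor_data
   \<Rightarrow> ('i, 'i \<times> 'i, ('k, 'm) module, 'm \<Rightarrow> 'm) functor_data"
  where "End_system C Ms =
    \<lparr>ob_map = (\<lambda>i. End_alg C (ob_map Ms i)),
     ar_map = (\<lambda>i j a. conj_map C (ob_map Ms i) (ob_map Ms j) (sys_mu Ms j i) (sys_nu Ms i j))\<rparr>"

definition T_dagger ::
  "('k, 'o, 'm) lin_category \<Rightarrow> 'i set \<Rightarrow> ('i \<Rightarrow> 'o) \<Rightarrow> 'o \<Rightarrow> ('i \<Rightarrow> 'm) \<Rightarrow> ('i \<Rightarrow> 'm) \<Rightarrow> 'm set"
  where "T_dagger C I Mi M \<mu> \<nu> =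
    {t \<in> Hom C M M. \<exists>i\<in>I. let e = Comp C M (Mi i) M (\<mu> i) (\<nu> i) in
       t = Comp C M M M e (Comp C M M M t e)}"

text \<open>\<open>T\<^sup>\<dagger>\<close> with the operations of \<open>T = End(M)\<close>; its \<open>one\<close> field is meaningless.\<close>

definition T_dagger_alg ::
  "('k, 'o, 'm) lin_category \<Rightarrow> 'i set \<Rightarrow> ('i \<Rightarrow> 'o) \<Rightarrow> 'o \<Rightarrow> ('i \<Rightarrow> 'm) \<Rightarrow> ('i \<Rightarrow> 'm) \<Rightarrow> ('k, 'm) module"
  where "T_dagger_alg C I Mi M \<mu> \<nu> = (End_alg C M)\<lparr>carrier := T_dagger C I Mi M \<mu> \<nu>\<rparr>"

text \<open>A category of firm algebras over one fixed type only tests the universal property of a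
  colimit against algebras on that type. \<open>firm_universal\<close> is the same universal property, for the
  cocone \<open>c\<close> with vertex \<open>L\<close> under \<open>F\<close>, against all firm algebras on a further, arbitrary type
  (\<open>'u\<close>, a parameter through the argument of type \<open>'u itself\<close>).\<close>

definition firm_universal ::
  "'u itself \<Rightarrow> ('k, 'z) ring_scheme \<Rightarrow> ('j, 'a, 'w) category_scheme
   \<Rightarrow> ('j, 'a, ('k, 'r) module, 'r \<Rightarrow> 'r) functor_data \<Rightarrow> ('k, 'r) module \<Rightarrow> ('j \<Rightarrow> 'r \<Rightarrow> 'r) \<Rightarrow> bool"
  where "firm_universal U K J F L c \<longleftrightarrow>
    (\<forall>(B :: ('k, 'u) module) d.
       firm K B \<and> (\<forall>i\<in>Obj J. d i \<in> alg_hom K (ob_map F i) B) \<and>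
       (\<forall>i\<in>Obj J. \<forall>j\<in>Obj J. \<forall>a\<in>Hom J i j.
          compose (carrier (ob_map F i)) (d j) (ar_map F i j a) = d i) \<longrightarrow>
       (\<exists>!h. h \<in> alg_hom K L B \<and> (\<forall>i\<in>Obj J. compose (carrier (ob_map F i)) h (c i) = d i)))"

end

theory Submission
  imports Defs
begin

text \<open>
  Since \<open>\<nu>\<^sub>i \<circ> \<mu>\<^sub>i\<close> is the identity, \<open>\<rho>\<^sub>i : t \<mapsto> \<mu>\<^sub>i \<circ> t \<circ> \<nu>\<^sub>i\<close> is an injective algebra homomorphism
  \<open>T\<^sub>i \<rightarrow> T\<close>, with the corner \<open>e\<^sub>i T e\<^sub>i\<close> as its image (\<open>conj_map_alg_hom\<close>, \<open>conj_map_inj\<close>,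
  \<open>conj_map_image\<close>). The \<open>\<rho>\<^sub>i\<close> are compatible with the transition maps of the system \<open>i \<mapsto> T\<^sub>i\<close>,
  because the \<open>\<mu>\<^sub>i\<close> form a cocone and the \<open>\<nu>\<^sub>i\<close> a cone (\<open>conj_map_comp\<close>). So \<open>T\<^sup>\<dagger>\<close> is a directed
  union of copies of the \<open>T\<^sub>i\<close> inside \<open>T\<close>, and any finite set of its elements lies in one copy.
  This gives closure under the operations, the local units \<open>e\<^sub>i = \<rho>\<^sub>i(1)\<close>, and the universal property
  of a colimit against algebras of any kind (\<open>union_is_subalgebra\<close>, \<open>union_idempotent_local_units\<close>,
  \<open>union_universal\<close>).

  Firmness follows from the local units (\<open>idempotent_local_units_imp_firm\<close>). If \<open>e\<close> is a unit for
  all left factors of a tensor, then \<open>\<Sum> x \<otimes> y = \<Sum> e x \<otimes> y = e \<otimes> \<Sum> x y\<close>, so that the multiplication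
  \<open>R \<otimes>\<^sub>R R \<rightarrow> R\<close> is injective; it is surjective because \<open>x = e x\<close>. In particular, the unital algebras
  \<open>T\<^sub>i\<close> are firm, and being a colimit among all algebras, \<open>T\<^sup>\<dagger>\<close> is one among the firm algebras.
\<close>

section \<open>Quotients and free modules\<close>

text \<open>The induced map picks the value of \<open>\<phi>\<close> on a whole coset, on which \<open>\<phi>\<close> is constant. For the
  additive structure this is the first isomorphism theorem for factor groups; what has to
  be added is that the scalar multiplication of the quotient, a union of cosets, is a single coset.\<close>

lemma first_isomorphism_quotient_module:
  assumes "module K F" "module K R"
    and closed: "\<And>x. x \<in> carrier F \<Longrightarrow> \<phi> x \<in> carrier R"
    and add: "\<And>x y. \<lbrakk>x \<in> carrier F; y \<in> carrier F\<rbrakk> \<Longrightarrow> \<phi> (x \<oplus>\<^bsub>F\<^esub> y) = \<phi> x \<oplus>\<^bsub>R\<^esub> \<phi> y"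
    and smult: "\<And>c x. \<lbrakk>c \<in> carrier K; x \<in> carrier F\<rbrakk> \<Longrightarrow> \<phi> (c \<odot>\<^bsub>F\<^esub> x) = c \<odot>\<^bsub>R\<^esub> \<phi> x"
    and onto: "\<phi> ` carrier F = carrier R"
    and N: "N = {x \<in> carrier F. \<phi> x = \<zero>\<^bsub>R\<^esub>}"
  defines "Q \<equiv> quotient_module K F N"
  defines "\<psi> \<equiv> (\<lambda>X\<in>carrier Q. the_elem (\<phi> ` X))"
  shows "\<psi> \<in> lin_hom K Q R" "bij_betw \<psi> (carrier Q) (carrier R)"
proof -
  interpret F: module K F by fact
  interpret R: module K R by fact
  interpret h: abelian_group_hom F R \<phi>
    by (intro abelian_group_homI F.abelian_group_axioms R.abelian_group_axioms group_hom.intro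
        F.M.a_group R.M.a_group group_hom_axioms.intro) (auto simp: hom_def closed add)
  have N': "N = a_kernel F R \<phi>" by (simp add: N a_kernel_def')
  interpret N: abelian_subgroup N F unfolding N' by (rule h.abelian_subgroup_a_kernel)
  have carr: "carrier (F A_Mod N) = carrier Q"
    by (simp add: Q_def quotient_module_def A_FactGroup_def FactGroup_def A_RCOSETS_def)
  have inj: "inj_on \<psi> (carrier Q)"
    using h.A_FactGroup_inj_on unfolding N'[symmetric] carr
    by (auto simp: inj_on_def \<psi>_def)
  have img: "\<psi> ` carrier Q = carrier R"
    using h.A_FactGroup_onto[OF onto] unfolding N'[symmetric] carr by (simp add: \<psi>_def)
  show bij: "bij_betw \<psi> (carrier Q) (carrier R)" using inj img by (simp add: bij_betw_def)
  have rep: "\<exists>x\<in>carrier F. X = N +>\<^bsub>F\<^esub> x" if "X \<in> carrier Q" for X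
    using that by (auto simp: Q_def quotient_module_def A_RCOSETS_def')
  have cosetQ: "N +>\<^bsub>F\<^esub> x \<in> carrier Q" if "x \<in> carrier F" for x
    using that by (auto simp: Q_def quotient_module_def A_RCOSETS_def')
  have val: "\<psi> (N +>\<^bsub>F\<^esub> x) = \<phi> x" if x: "x \<in> carrier F" for x
  proof -
    have "\<phi> ` (N +>\<^bsub>F\<^esub> x) = {\<phi> x}"
    proof -
      have "\<phi> y = \<phi> x" if y: "y \<in> N +>\<^bsub>F\<^esub> x" for y
      proof -
        obtain n where n: "n \<in> N" "y = n \<oplus>\<^bsub>F\<^esub> x" using y by (auto simp: a_r_coset_def')
        then have "n \<in> carrier F" "\<phi> n = \<zero>\<^bsub>R\<^esub>" unfolding N by simp_all
        then show ?thesis using n x by (simp add: closed)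
      qed
      moreover have "x \<in> N +>\<^bsub>F\<^esub> x" using x by (rule N.a_rcos_self)
      ultimately show ?thesis by blast
    qed
    then show ?thesis using cosetQ[OF x] by (simp add: \<psi>_def)
  qed
  have smultQ: "c \<odot>\<^bsub>Q\<^esub> (N +>\<^bsub>F\<^esub> x) = N +>\<^bsub>F\<^esub> (c \<odot>\<^bsub>F\<^esub> x)"
    if c: "c \<in> carrier K" and x: "x \<in> carrier F" for c x
  proof -
    have "N +>\<^bsub>F\<^esub> (c \<odot>\<^bsub>F\<^esub> y) = N +>\<^bsub>F\<^esub> (c \<odot>\<^bsub>F\<^esub> x)" if y: "y \<in> N +>\<^bsub>F\<^esub> x" for y
    proof -
      obtain n where n: "n \<in> N" "y = n \<oplus>\<^bsub>F\<^esub> x" using y by (auto simp: a_r_coset_def')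
      then have "n \<in> carrier F" "\<phi> n = \<zero>\<^bsub>R\<^esub>" unfolding N by simp_all
      then have "c \<odot>\<^bsub>F\<^esub> n \<in> N" using c unfolding N by (simp add: smult)
      moreover have "c \<odot>\<^bsub>F\<^esub> y = c \<odot>\<^bsub>F\<^esub> n \<oplus>\<^bsub>F\<^esub> c \<odot>\<^bsub>F\<^esub> x"
        using n c x \<open>n \<in> carrier F\<close> by (simp add: F.smult_r_distr)
      ultimately have "c \<odot>\<^bsub>F\<^esub> y \<in> N +>\<^bsub>F\<^esub> (c \<odot>\<^bsub>F\<^esub> x)" by (auto simp: a_r_coset_def')
      then show ?thesis
        using N.a_repr_independence'[of "c \<odot>\<^bsub>F\<^esub> y" "c \<odot>\<^bsub>F\<^esub> x"] c x by simp
    qed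
    moreover have "x \<in> N +>\<^bsub>F\<^esub> x" using x by (rule N.a_rcos_self)
    ultimately have "(\<Union>y\<in>N +>\<^bsub>F\<^esub> x. N +>\<^bsub>F\<^esub> (c \<odot>\<^bsub>F\<^esub> y)) = N +>\<^bsub>F\<^esub> (c \<odot>\<^bsub>F\<^esub> x)"
      by blast
    then show ?thesis by (simp add: Q_def quotient_module_def)
  qed
  have addQ: "(N +>\<^bsub>F\<^esub> x) \<oplus>\<^bsub>Q\<^esub> (N +>\<^bsub>F\<^esub> y) = N +>\<^bsub>F\<^esub> (x \<oplus>\<^bsub>F\<^esub> y)"
    if "x \<in> carrier F" "y \<in> carrier F" for x y
    using N.a_rcos_sum[OF that] by (simp add: Q_def quotient_module_def)
  have "\<psi> (X \<oplus>\<^bsub>Q\<^esub> Y) = \<psi> X \<oplus>\<^bsub>R\<^esub> \<psi> Y" if X: "X \<in> carrier Q" and Y: "Y \<in> carrier Q" for X Y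
    using rep[OF X] rep[OF Y] by (auto simp: addQ val add)
  moreover have "\<psi> (c \<odot>\<^bsub>Q\<^esub> X) = c \<odot>\<^bsub>R\<^esub> \<psi> X" if c: "c \<in> carrier K" and X: "X \<in> carrier Q" for c X
    using rep[OF X] c by (auto simp: smultQ val smult)
  moreover have "\<psi> \<in> carrier Q \<rightarrow>\<^sub>E carrier R"
    using img by (auto simp: \<psi>_def)
  ultimately show "\<psi> \<in> lin_hom K Q R" by (simp add: lin_hom_def)
qed

lemma free_module_is_module:
  assumes "cring K"
  shows "module K (free_module K S)"
proof -
  interpret cring K by fact
  let ?F = "free_module K S"
  have fin: "finite {s. f s \<oplus>\<^bsub>K\<^esub> g s \<noteq> \<zero>\<^bsub>K\<^esub>}"
    if "f \<in> carrier ?F" "g \<in> carrier ?F" for f g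
    by (rule finite_subset[of _ "{s. f s \<noteq> \<zero>\<^bsub>K\<^esub>} \<union> {s. g s \<noteq> \<zero>\<^bsub>K\<^esub>}"])
      (use that in \<open>auto simp: free_module_def\<close>)
  have fin': "finite {s. c \<otimes>\<^bsub>K\<^esub> f s \<noteq> \<zero>\<^bsub>K\<^esub>}"
    if "f \<in> carrier ?F" "c \<in> carrier K" for f c
    by (rule finite_subset[of _ "{s. f s \<noteq> \<zero>\<^bsub>K\<^esub>}"])
      (use that in \<open>auto simp: free_module_def\<close>)
  have val: "f s \<in> carrier K" if "f \<in> carrier ?F" for f s
    using that by (cases "s \<in> S") (auto simp: free_module_def)
  have smult_in: "c \<odot>\<^bsub>?F\<^esub> f \<in> carrier ?F" if "c \<in> carrier K" "f \<in> carrier ?F" for c f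
    using that fin'[OF that(2,1)] by (auto simp: free_module_def)
  have ag: "abelian_group ?F"
  proof (rule abelian_groupI)
    fix f g assume "f \<in> carrier ?F" "g \<in> carrier ?F"
    then show "f \<oplus>\<^bsub>?F\<^esub> g \<in> carrier ?F" using fin[of f g] by (auto simp: free_module_def)
  next
    fix f assume f: "f \<in> carrier ?F"
    have "(\<ominus>\<^bsub>K\<^esub> \<one>\<^bsub>K\<^esub>) \<odot>\<^bsub>?F\<^esub> f \<oplus>\<^bsub>?F\<^esub> f = \<zero>\<^bsub>?F\<^esub>"
      using val[OF f] by (simp add: free_module_def fun_eq_iff l_minus l_neg)
    then show "\<exists>g\<in>carrier ?F. g \<oplus>\<^bsub>?F\<^esub> f = \<zero>\<^bsub>?F\<^esub>" using smult_in[OF _ f] by blast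
  next
    show "\<zero>\<^bsub>?F\<^esub> \<in> carrier ?F" by (simp add: free_module_def)
  next
    fix f g h assume "f \<in> carrier ?F" "g \<in> carrier ?F" "h \<in> carrier ?F"
    then have "\<And>s. f s \<in> carrier K \<and> g s \<in> carrier K \<and> h s \<in> carrier K" using val by blast
    then show "f \<oplus>\<^bsub>?F\<^esub> g \<oplus>\<^bsub>?F\<^esub> h = f \<oplus>\<^bsub>?F\<^esub> (g \<oplus>\<^bsub>?F\<^esub> h)"
      by (simp add: free_module_def fun_eq_iff a_assoc)
  next
    fix f g assume "f \<in> carrier ?F" "g \<in> carrier ?F"
    then have "\<And>s. f s \<in> carrier K \<and> g s \<in> carrier K" using val by blast
    then show "f \<oplus>\<^bsub>?F\<^esub> g = g \<oplus>\<^bsub>?F\<^esub> f"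
      by (simp add: free_module_def fun_eq_iff a_comm)
  next
    fix f assume "f \<in> carrier ?F"
    then have "\<And>s. f s \<in> carrier K" using val by blast
    then show "\<zero>\<^bsub>?F\<^esub> \<oplus>\<^bsub>?F\<^esub> f = f" by (simp add: free_module_def fun_eq_iff)
  qed
  show ?thesis
  proof (rule moduleI[OF assms ag smult_in])
    fix a b f assume *: "a \<in> carrier K" "b \<in> carrier K" "f \<in> carrier ?F"
    then have "\<And>s. f s \<in> carrier K" using val by blast
    with * show "(a \<oplus>\<^bsub>K\<^esub> b) \<odot>\<^bsub>?F\<^esub> f = a \<odot>\<^bsub>?F\<^esub> f \<oplus>\<^bsub>?F\<^esub> b \<odot>\<^bsub>?F\<^esub> f"
      and "(a \<otimes>\<^bsub>K\<^esub> b) \<odot>\<^bsub>?F\<^esub> f = a \<odot>\<^bsub>?F\<^esub> (b \<odot>\<^bsub>?F\<^esub> f)"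
      by (simp_all add: free_module_def fun_eq_iff l_distr m_assoc)
  next
    fix a f g assume *: "a \<in> carrier K" "f \<in> carrier ?F" "g \<in> carrier ?F"
    then have "\<And>s. f s \<in> carrier K \<and> g s \<in> carrier K" using val by blast
    with * show "a \<odot>\<^bsub>?F\<^esub> (f \<oplus>\<^bsub>?F\<^esub> g) = a \<odot>\<^bsub>?F\<^esub> f \<oplus>\<^bsub>?F\<^esub> a \<odot>\<^bsub>?F\<^esub> g"
      by (simp add: free_module_def fun_eq_iff r_distr)
  next
    fix f assume "f \<in> carrier ?F"
    then have "\<And>s. f s \<in> carrier K" using val by blast
    then show "\<one>\<^bsub>K\<^esub> \<odot>\<^bsub>?F\<^esub> f = f" by (simp add: free_module_def fun_eq_iff)
  qed
qed

lemma basis_elt_in_free_module: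
  assumes "cring K" "s \<in> S"
  shows "basis_elt K s \<in> carrier (free_module K S)"
proof -
  interpret cring K by fact
  have "finite {t. basis_elt K s t \<noteq> \<zero>\<^bsub>K\<^esub>}"
    by (rule finite_subset[of _ "{s}"]) (auto simp: basis_elt_def)
  then show ?thesis using assms(2) by (auto simp: free_module_def basis_elt_def)
qed

lemma free_module_value_closed:
  assumes "cring K" "f \<in> carrier (free_module K S)"
  shows "f s \<in> carrier K"
proof -
  interpret cring K by fact
  show ?thesis using assms(2) by (cases "s \<in> S") (auto simp: free_module_def)
qed

text \<open>A finitely supported function is the sum of its values times the basis elements, so a
  submodule containing the basis elements at the support contains the function. The induction
  runs over a finite superset of the support, setting one value to zero at a time.\<close>

lemma free_module_spanned_by_support:
  assumes "cring K" "submodule H K (free_module K S)" "f \<in> carrier (free_module K S)"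
    and "\<And>s. f s \<noteq> \<zero>\<^bsub>K\<^esub> \<Longrightarrow> basis_elt K s \<in> H"
  shows "f \<in> H"
proof -
  interpret cring K by fact
  let ?F = "free_module K S"
  interpret F: module K ?F by (rule free_module_is_module) fact
  note H = F.submoduleE[OF assms(2)]
  have zero: "(\<lambda>s. \<zero>\<^bsub>K\<^esub>) \<in> H"
  proof -
    obtain g where g: "g \<in> H" using H(2) by blast
    then have "\<zero>\<^bsub>K\<^esub> \<odot>\<^bsub>?F\<^esub> g = \<zero>\<^bsub>?F\<^esub>" using H(1) by (intro F.smult_l_null) auto
    with H(4)[OF zero_closed g] show ?thesis by (simp add: free_module_def)
  qed
  have "g \<in> H" if "finite A" "g \<in> carrier ?F" "{s. g s \<noteq> \<zero>\<^bsub>K\<^esub>} \<subseteq> A"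
    "\<And>s. g s \<noteq> \<zero>\<^bsub>K\<^esub> \<Longrightarrow> basis_elt K s \<in> H" for A g
    using that
  proof (induction A arbitrary: g rule: finite_induct)
    case empty
    then have "g = (\<lambda>s. \<zero>\<^bsub>K\<^esub>)" by auto
    then show ?case using zero by simp
  next
    case (insert a A)
    have gs: "g s \<in> carrier K" for s
      using assms(1) insert.prems(1) by (rule free_module_value_closed)
    have "finite {s. (g(a := \<zero>\<^bsub>K\<^esub>)) s \<noteq> \<zero>\<^bsub>K\<^esub>}"
      by (rule finite_subset[of _ "{s. g s \<noteq> \<zero>\<^bsub>K\<^esub>}"])
        (use insert.prems(1) in \<open>auto simp: free_module_def\<close>)
    then have "g(a := \<zero>\<^bsub>K\<^esub>) \<in> carrier ?F"
      using insert.prems(1) by (auto simp: free_module_def)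
    then have r: "g(a := \<zero>\<^bsub>K\<^esub>) \<in> H"
    proof (rule insert.IH)
      show "{s. (g(a := \<zero>\<^bsub>K\<^esub>)) s \<noteq> \<zero>\<^bsub>K\<^esub>} \<subseteq> A" using insert.prems(2) by auto
      show "\<And>s. (g(a := \<zero>\<^bsub>K\<^esub>)) s \<noteq> \<zero>\<^bsub>K\<^esub> \<Longrightarrow> basis_elt K s \<in> H"
        using insert.prems(3) by (auto split: if_splits)
    qed
    show ?case
    proof (cases "g a = \<zero>\<^bsub>K\<^esub>")
      case True
      then have "g(a := \<zero>\<^bsub>K\<^esub>) = g" by auto
      then show ?thesis using r by simp
    next
      case False
      then have "g a \<odot>\<^bsub>?F\<^esub> basis_elt K a \<in> H" using H(4) gs insert.prems(3) by blast
      with r have "g(a := \<zero>\<^bsub>K\<^esub>) \<oplus>\<^bsub>?F\<^esub> g a \<odot>\<^bsub>?F\<^esub> basis_elt K a \<in> H" by (rule H(5))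
      moreover have "g(a := \<zero>\<^bsub>K\<^esub>) \<oplus>\<^bsub>?F\<^esub> g a \<odot>\<^bsub>?F\<^esub> basis_elt K a = g"
        using gs by (auto simp: free_module_def basis_elt_def)
      ultimately show ?thesis by simp
    qed
  qed
  moreover have "finite {s. f s \<noteq> \<zero>\<^bsub>K\<^esub>}" using assms(3) by (simp add: free_module_def)
  ultimately show ?thesis using assms(3,4) by blast
qed

context abelian_group
begin

lemma minus_minus_swap:
  assumes "a \<in> carrier G" "b \<in> carrier G"
  shows "\<ominus> (a \<ominus> b) = b \<ominus> a"
  using assms by (simp add: minus_eq minus_add a_comm)

lemma minus_telescope:
  assumes "a \<in> carrier G" "b \<in> carrier G" "c \<in> carrier G"
  shows "(a \<ominus> b) \<oplus> (b \<ominus> c) = a \<ominus> c"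
  using assms by (simp add: minus_eq a_assoc r_neg1)

lemma minus_add_minus:
  assumes "a \<in> carrier G" "b \<in> carrier G" "c \<in> carrier G" "d \<in> carrier G"
  shows "(a \<ominus> b) \<oplus> (c \<ominus> d) = (a \<oplus> c) \<ominus> (b \<oplus> d)"
proof -
  have "\<ominus> b \<oplus> (c \<oplus> \<ominus> d) = c \<oplus> (\<ominus> b \<oplus> \<ominus> d)"
    using assms by (simp add: a_lcomm)
  then show ?thesis using assms by (simp add: minus_eq a_assoc minus_add)
qed

end

lemma (in module) submodule_hull:
  assumes "X \<subseteq> carrier M"
  shows "submodule ((\<lambda>N. submodule N R M) hull X) R M"
proof -
  let ?T = "{t. submodule t R M \<and> X \<subseteq> t}"
  have sub: "submodule t R M" if "t \<in> ?T" for t using that by simp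
  have ne: "carrier M \<in> ?T" using assms carrier_is_submodule by simp
  show ?thesis unfolding hull_def
  proof (rule submoduleI)
    show "\<Inter>?T \<subseteq> carrier M" using ne by blast
    have "\<zero>\<^bsub>M\<^esub> \<in> t" if "t \<in> ?T" for t
      using submodule.axioms(1)[OF sub[OF that]] subgroup.one_closed by fastforce
    then show "\<zero>\<^bsub>M\<^esub> \<in> \<Inter>?T" by blast
  next
    fix a assume "a \<in> \<Inter>?T"
    then show "\<ominus>\<^bsub>M\<^esub> a \<in> \<Inter>?T" using submoduleE(3)[OF sub] by blast
  next
    fix a b assume "a \<in> \<Inter>?T" "b \<in> \<Inter>?T"
    then show "a \<oplus>\<^bsub>M\<^esub> b \<in> \<Inter>?T" using submoduleE(5)[OF sub] by blast
  next
    fix c a assume "c \<in> carrier R" "a \<in> \<Inter>?T"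
    then show "c \<odot>\<^bsub>M\<^esub> a \<in> \<Inter>?T" using submoduleE(4)[OF sub] by blast
  qed
qed

section \<open>Algebras with local units are firm\<close>

context k_algebra
begin

abbreviation free_square :: "('k, 'r \<times> 'r \<Rightarrow> 'k) module"
  where "free_square \<equiv> free_module K (carrier R \<times> carrier R)"

abbreviation generator :: "'r \<Rightarrow> 'r \<Rightarrow> 'r \<times> 'r \<Rightarrow> 'k"
  where "generator x y \<equiv> basis_elt K (x, y)"

abbreviation relation_span :: "('r \<times> 'r \<Rightarrow> 'k) set"
  where "relation_span \<equiv> (\<lambda>N. submodule N K free_square) hull tensor_relations K R"

lemma module_free_square: "module K free_square"
  by (rule free_module_is_module) (rule R.cring_axioms)

lemma generator_closed: "\<lbrakk>x \<in> carrier R; y \<in> carrier R\<rbrakk> \<Longrightarrow> generator x y \<in> carrier free_square"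
  by (rule basis_elt_in_free_module[OF R.cring_axioms]) simp

lemma free_square_values: "f \<in> carrier free_square \<Longrightarrow> f p \<in> carrier K"
  using R.cring_axioms by (rule free_module_value_closed)

lemma free_square_support:
  "f \<in> carrier free_square \<Longrightarrow>
    finite {p. f p \<noteq> \<zero>\<^bsub>K\<^esub>} \<and> {p. f p \<noteq> \<zero>\<^bsub>K\<^esub>} \<subseteq> carrier R \<times> carrier R"
  by (auto simp: free_module_def)

text \<open>Two elements of the free module have different supports; evaluating the sums that define their
  products over a common finite superset is what makes the multiplication map additive.\<close>

lemma free_mult_map_superset:
  assumes "f \<in> carrier free_square" "finite A" "A \<subseteq> carrier R \<times> carrier R"
    and "{p. f p \<noteq> \<zero>\<^bsub>K\<^esub>} \<subseteq> A"
  shows "free_mult_map K R f = (\<Oplus>\<^bsub>R\<^esub>p\<in>A. f p \<odot>\<^bsub>R\<^esub> (fst p \<otimes>\<^bsub>R\<^esub> snd p))"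
  unfolding free_mult_map_def
proof (rule M.add.finprod_mono_neutral_cong_left)
  have prod: "fst p \<otimes>\<^bsub>R\<^esub> snd p \<in> carrier R" if "p \<in> A" for p
    using that assms(3) by (intro m_closed) auto
  show "f i \<odot>\<^bsub>R\<^esub> (fst i \<otimes>\<^bsub>R\<^esub> snd i) = \<zero>\<^bsub>R\<^esub>" if "i \<in> A - {p. f p \<noteq> \<zero>\<^bsub>K\<^esub>}" for i
    using that prod by simp
  show "(\<lambda>p. f p \<odot>\<^bsub>R\<^esub> (fst p \<otimes>\<^bsub>R\<^esub> snd p)) \<in> A \<rightarrow> carrier R"
    using prod free_square_values[OF assms(1)] by auto
qed (use assms in auto)

lemma free_mult_map_closed:
  "f \<in> carrier free_square \<Longrightarrow> free_mult_map K R f \<in> carrier R"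
  unfolding free_mult_map_def using free_square_support[of f] free_square_values[of f]
  by (intro M.finsum_closed) (auto intro!: smult_closed m_closed)

lemma free_mult_map_add:
  assumes f: "f \<in> carrier free_square" and g: "g \<in> carrier free_square"
  shows "free_mult_map K R (f \<oplus>\<^bsub>free_square\<^esub> g) = free_mult_map K R f \<oplus>\<^bsub>R\<^esub> free_mult_map K R g"
proof -
  interpret F: module K free_square by (rule module_free_square)
  let ?A = "{p. f p \<noteq> \<zero>\<^bsub>K\<^esub>} \<union> {p. g p \<noteq> \<zero>\<^bsub>K\<^esub>}"
  have A: "finite ?A" "?A \<subseteq> carrier R \<times> carrier R"
    using free_square_support[OF f] free_square_support[OF g] by auto
  have prod: "fst p \<otimes>\<^bsub>R\<^esub> snd p \<in> carrier R" if "p \<in> ?A" for p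
    using that A(2) by (intro m_closed) auto
  have fg: "(f \<oplus>\<^bsub>free_square\<^esub> g) p = f p \<oplus>\<^bsub>K\<^esub> g p" for p
    by (simp add: free_module_def)
  have supp: "{p. (f \<oplus>\<^bsub>free_square\<^esub> g) p \<noteq> \<zero>\<^bsub>K\<^esub>} \<subseteq> ?A"
    unfolding fg by auto
  have "free_mult_map K R (f \<oplus>\<^bsub>free_square\<^esub> g) =
      (\<Oplus>\<^bsub>R\<^esub>p\<in>?A. (f \<oplus>\<^bsub>free_square\<^esub> g) p \<odot>\<^bsub>R\<^esub> (fst p \<otimes>\<^bsub>R\<^esub> snd p))"
    by (rule free_mult_map_superset[OF F.M.a_closed[OF f g] A supp])
  also have "\<dots> = (\<Oplus>\<^bsub>R\<^esub>p\<in>?A. f p \<odot>\<^bsub>R\<^esub> (fst p \<otimes>\<^bsub>R\<^esub> snd p) \<oplus>\<^bsub>R\<^esub> g p \<odot>\<^bsub>R\<^esub> (fst p \<otimes>\<^bsub>R\<^esub> snd p))"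
    unfolding fg using prod free_square_values[OF f] free_square_values[OF g]
    by (intro M.finsum_cong') (auto simp: smult_l_distr)
  also have "\<dots> = (\<Oplus>\<^bsub>R\<^esub>p\<in>?A. f p \<odot>\<^bsub>R\<^esub> (fst p \<otimes>\<^bsub>R\<^esub> snd p)) \<oplus>\<^bsub>R\<^esub> (\<Oplus>\<^bsub>R\<^esub>p\<in>?A. g p \<odot>\<^bsub>R\<^esub> (fst p \<otimes>\<^bsub>R\<^esub> snd p))"
    using prod free_square_values[OF f] free_square_values[OF g]
    by (intro M.finsum_addf) auto
  also have "\<dots> = free_mult_map K R f \<oplus>\<^bsub>R\<^esub> free_mult_map K R g"
    by (simp add: free_mult_map_superset[OF f A] free_mult_map_superset[OF g A])
  finally show ?thesis .
qed

lemma free_mult_map_smult: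
  assumes c: "c \<in> carrier K" and f: "f \<in> carrier free_square"
  shows "free_mult_map K R (c \<odot>\<^bsub>free_square\<^esub> f) = c \<odot>\<^bsub>R\<^esub> free_mult_map K R f"
proof -
  interpret F: module K free_square by (rule module_free_square)
  let ?A = "{p. f p \<noteq> \<zero>\<^bsub>K\<^esub>}"
  have A: "finite ?A" "?A \<subseteq> carrier R \<times> carrier R"
    using free_square_support[OF f] by auto
  have prod: "fst p \<otimes>\<^bsub>R\<^esub> snd p \<in> carrier R" if "p \<in> ?A" for p
    using that A(2) by (intro m_closed) auto
  have cf: "(c \<odot>\<^bsub>free_square\<^esub> f) p = c \<otimes>\<^bsub>K\<^esub> f p" for p
    by (simp add: free_module_def)
  have supp: "{p. (c \<odot>\<^bsub>free_square\<^esub> f) p \<noteq> \<zero>\<^bsub>K\<^esub>} \<subseteq> ?A"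
    unfolding cf using c by auto
  have "free_mult_map K R (c \<odot>\<^bsub>free_square\<^esub> f) =
      (\<Oplus>\<^bsub>R\<^esub>p\<in>?A. (c \<odot>\<^bsub>free_square\<^esub> f) p \<odot>\<^bsub>R\<^esub> (fst p \<otimes>\<^bsub>R\<^esub> snd p))"
    by (rule free_mult_map_superset[OF F.smult_closed[OF c f] A supp])
  also have "\<dots> = (\<Oplus>\<^bsub>R\<^esub>p\<in>?A. c \<odot>\<^bsub>R\<^esub> (f p \<odot>\<^bsub>R\<^esub> (fst p \<otimes>\<^bsub>R\<^esub> snd p)))"
    unfolding cf using prod free_square_values[OF f] c
    by (intro M.finsum_cong') (auto simp: smult_assoc1)
  also have "\<dots> = c \<odot>\<^bsub>R\<^esub> (\<Oplus>\<^bsub>R\<^esub>p\<in>?A. f p \<odot>\<^bsub>R\<^esub> (fst p \<otimes>\<^bsub>R\<^esub> snd p))"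
    using prod free_square_values[OF f] c A
    by (intro finsum_smult_ldistr[symmetric]) auto
  also have "\<dots> = c \<odot>\<^bsub>R\<^esub> free_mult_map K R f" by (simp add: free_mult_map_def)
  finally show ?thesis .
qed

lemma free_mult_map_generator:
  assumes "x \<in> carrier R" "y \<in> carrier R"
  shows "free_mult_map K R (generator x y) = x \<otimes>\<^bsub>R\<^esub> y"
proof -
  have "free_mult_map K R (generator x y) =
      (\<Oplus>\<^bsub>R\<^esub>p\<in>{(x, y)}. generator x y p \<odot>\<^bsub>R\<^esub> (fst p \<otimes>\<^bsub>R\<^esub> snd p))"
    using assms by (intro free_mult_map_superset generator_closed) (auto simp: basis_elt_def)
  also have "\<dots> = x \<otimes>\<^bsub>R\<^esub> y"
    using assms by (simp add: M.finsum_insert basis_elt_def m_closed)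
  finally show ?thesis .
qed

lemma submodule_mult_kernel:
  "submodule {f \<in> carrier free_square. free_mult_map K R f = \<zero>\<^bsub>R\<^esub>} K free_square"
proof -
  interpret F: module K free_square by (rule module_free_square)
  have neg: "\<ominus>\<^bsub>free_square\<^esub> f = (\<ominus>\<^bsub>K\<^esub> \<one>\<^bsub>K\<^esub>) \<odot>\<^bsub>free_square\<^esub> f" if "f \<in> carrier free_square" for f
    using F.smult_l_minus[OF R.one_closed that] F.smult_one[OF that] by simp
  have zero: "free_mult_map K R \<zero>\<^bsub>free_square\<^esub> = \<zero>\<^bsub>R\<^esub>"
    by (simp add: free_mult_map_def free_module_def)
  show ?thesis
    by (rule F.submoduleI)
      (auto simp: zero neg free_mult_map_add free_mult_map_smult)
qed

lemma free_mult_map_diff_zero: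
  assumes "f \<in> carrier free_square" "g \<in> carrier free_square"
  shows "free_mult_map K R (f \<ominus>\<^bsub>free_square\<^esub> g) = \<zero>\<^bsub>R\<^esub> \<longleftrightarrow> free_mult_map K R f = free_mult_map K R g"
proof -
  interpret F: module K free_square by (rule module_free_square)
  have "f = (f \<ominus>\<^bsub>free_square\<^esub> g) \<oplus>\<^bsub>free_square\<^esub> g"
    using assms by (simp add: F.M.minus_eq F.M.a_assoc F.M.l_neg)
  then have "free_mult_map K R f = free_mult_map K R (f \<ominus>\<^bsub>free_square\<^esub> g) \<oplus>\<^bsub>R\<^esub> free_mult_map K R g"
    using free_mult_map_add[of "f \<ominus>\<^bsub>free_square\<^esub> g" g] assms by simp
  then show ?thesis
    using assms free_mult_map_closed[of f] free_mult_map_closed[of g]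
      free_mult_map_closed[of "f \<ominus>\<^bsub>free_square\<^esub> g"] M.add.l_cancel_one' M.add.r_cancel_one by auto
qed

text \<open>The tensor relations express exactly bilinearity and associativity of the product. Since the
  kernel is a submodule, it contains their span as well.\<close>

lemma tensor_relations_in_kernel:
  "tensor_relations K R \<subseteq> {f \<in> carrier free_square. free_mult_map K R f = \<zero>\<^bsub>R\<^esub>}"
proof -
  interpret F: module K free_square by (rule module_free_square)
  show ?thesis
    unfolding tensor_relations_def Let_def
    by (auto simp: free_mult_map_diff_zero generator_closed free_mult_map_generator
        free_mult_map_add free_mult_map_smult smult_closed m_closed m_assoc m_l_distr m_r_distr
        smult_m_left smult_m_right)
qed

lemma submodule_relation_span: "submodule relation_span K free_square"
  using tensor_relations_in_kernel
  by (intro module.submodule_hull[OF module_free_square]) auto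

text \<open>The heart of firmness: if \<open>e\<close> fixes the left factors occurring in \<open>\<Sum> c (x \<otimes> y)\<close>, then
  \<open>x \<otimes> y = e x \<otimes> y = e \<otimes> x y\<close> for each term, so that the sum equals \<open>e \<otimes> \<Sum> c x y\<close>. Hence
  tensors that share such an \<open>e\<close> are determined by their products.\<close>

lemma free_element_as_single_tensor:
  assumes e: "e \<in> carrier R" and f: "f \<in> carrier free_square"
    and unit: "\<And>x y. f (x, y) \<noteq> \<zero>\<^bsub>K\<^esub> \<Longrightarrow> e \<otimes>\<^bsub>R\<^esub> x = x"
  shows "f \<ominus>\<^bsub>free_square\<^esub> generator e (free_mult_map K R f) \<in> relation_span"
proof -
  interpret F: module K free_square by (rule module_free_square)
  note N = F.submoduleE[OF submodule_relation_span]
  let ?\<phi> = "free_mult_map K R"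
  have rel: "t \<in> relation_span" if "t \<in> tensor_relations K R" for t
    using that by (rule hull_inc)
  have gen: "generator e x \<in> carrier free_square" if "x \<in> carrier R" for x
    using that e by (rule generator_closed[rotated])
  have rel_add: "generator e x \<oplus>\<^bsub>free_square\<^esub> generator e y
      \<ominus>\<^bsub>free_square\<^esub> generator e (x \<oplus>\<^bsub>R\<^esub> y) \<in> relation_span"
    if xy: "x \<in> carrier R" "y \<in> carrier R" for x y
  proof -
    have "generator e (x \<oplus>\<^bsub>R\<^esub> y)
        \<ominus>\<^bsub>free_square\<^esub> (generator e x \<oplus>\<^bsub>free_square\<^esub> generator e y) \<in> relation_span"
      by (rule rel, unfold tensor_relations_def Let_def) (use e xy in blast)
    from N(3)[OF this] show ?thesis
      using gen xy by (simp add: F.M.minus_minus_swap)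
  qed
  have rel_smult: "c \<odot>\<^bsub>free_square\<^esub> generator e x
      \<ominus>\<^bsub>free_square\<^esub> generator e (c \<odot>\<^bsub>R\<^esub> x) \<in> relation_span"
    if cx: "c \<in> carrier K" "x \<in> carrier R" for c x
  proof -
    have "generator e (c \<odot>\<^bsub>R\<^esub> x) \<ominus>\<^bsub>free_square\<^esub> c \<odot>\<^bsub>free_square\<^esub> generator e x \<in> relation_span"
      by (rule rel, unfold tensor_relations_def Let_def) (use e cx in blast)
    from N(3)[OF this] show ?thesis
      using gen cx by (simp add: F.M.minus_minus_swap)
  qed
  have smult_minus: "c \<odot>\<^bsub>free_square\<^esub> (g \<ominus>\<^bsub>free_square\<^esub> h)
      = c \<odot>\<^bsub>free_square\<^esub> g \<ominus>\<^bsub>free_square\<^esub> c \<odot>\<^bsub>free_square\<^esub> h"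
    if "c \<in> carrier K" "g \<in> carrier free_square" "h \<in> carrier free_square" for c g h
    using that by (simp add: F.M.minus_eq F.smult_r_distr F.smult_r_minus)
  \<comment> \<open>The claim for \<open>g\<close> in place of \<open>f\<close> is stable under linear combinations, because
    \<open>y \<mapsto> e \<otimes> y\<close> is linear modulo the relations; it then suffices to check the generators.\<close>
  define H where "H = {g \<in> carrier free_square.
    g \<ominus>\<^bsub>free_square\<^esub> generator e (?\<phi> g) \<in> relation_span}"
  have H_smult: "c \<odot>\<^bsub>free_square\<^esub> g \<in> H" if c: "c \<in> carrier K" and g: "g \<in> H" for c g
  proof -
    let ?d = "generator e (?\<phi> g)" and ?d' = "generator e (c \<odot>\<^bsub>R\<^esub> ?\<phi> g)"
    have carr: "g \<in> carrier free_square" "?d \<in> carrier free_square" "?d' \<in> carrier free_square"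
      using g c by (auto simp: H_def intro!: gen free_mult_map_closed)
    have "c \<odot>\<^bsub>free_square\<^esub> (g \<ominus>\<^bsub>free_square\<^esub> ?d) \<oplus>\<^bsub>free_square\<^esub>
        (c \<odot>\<^bsub>free_square\<^esub> ?d \<ominus>\<^bsub>free_square\<^esub> ?d') \<in> relation_span"
      using g c by (intro N(5) N(4) rel_smult) (auto simp: H_def intro!: free_mult_map_closed)
    also have "c \<odot>\<^bsub>free_square\<^esub> (g \<ominus>\<^bsub>free_square\<^esub> ?d) \<oplus>\<^bsub>free_square\<^esub>
        (c \<odot>\<^bsub>free_square\<^esub> ?d \<ominus>\<^bsub>free_square\<^esub> ?d') = c \<odot>\<^bsub>free_square\<^esub> g \<ominus>\<^bsub>free_square\<^esub> ?d'"
      using carr c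
      by (simp add: smult_minus F.M.minus_telescope)
    finally show ?thesis using c carr by (simp add: H_def free_mult_map_smult)
  qed
  have H_add: "g \<oplus>\<^bsub>free_square\<^esub> h \<in> H" if g: "g \<in> H" and h: "h \<in> H" for g h
  proof -
    let ?d = "generator e (?\<phi> g)" and ?d' = "generator e (?\<phi> h)"
      and ?d'' = "generator e (?\<phi> g \<oplus>\<^bsub>R\<^esub> ?\<phi> h)"
    have carr: "g \<in> carrier free_square" "h \<in> carrier free_square" "?d \<in> carrier free_square"
      "?d' \<in> carrier free_square" "?d'' \<in> carrier free_square"
      using g h by (auto simp: H_def intro!: gen free_mult_map_closed)
    have "(g \<ominus>\<^bsub>free_square\<^esub> ?d) \<oplus>\<^bsub>free_square\<^esub> (h \<ominus>\<^bsub>free_square\<^esub> ?d')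
        \<oplus>\<^bsub>free_square\<^esub> (?d \<oplus>\<^bsub>free_square\<^esub> ?d' \<ominus>\<^bsub>free_square\<^esub> ?d'') \<in> relation_span"
      using g h by (intro N(5) rel_add) (auto simp: H_def intro!: free_mult_map_closed)
    also have "(g \<ominus>\<^bsub>free_square\<^esub> ?d) \<oplus>\<^bsub>free_square\<^esub> (h \<ominus>\<^bsub>free_square\<^esub> ?d')
        \<oplus>\<^bsub>free_square\<^esub> (?d \<oplus>\<^bsub>free_square\<^esub> ?d' \<ominus>\<^bsub>free_square\<^esub> ?d'')
        = g \<oplus>\<^bsub>free_square\<^esub> h \<ominus>\<^bsub>free_square\<^esub> ?d''"
      using carr by (simp add: F.M.minus_add_minus[of g ?d h ?d'] F.M.minus_telescope)
    finally show ?thesis using carr by (simp add: H_def free_mult_map_add)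
  qed
  have H_gen: "generator x y \<in> H" if xy: "x \<in> carrier R" "y \<in> carrier R" and ex: "e \<otimes>\<^bsub>R\<^esub> x = x" for x y
  proof -
    have "generator (e \<otimes>\<^bsub>R\<^esub> x) y \<ominus>\<^bsub>free_square\<^esub> generator e (x \<otimes>\<^bsub>R\<^esub> y) \<in> relation_span"
      by (rule rel, unfold tensor_relations_def Let_def) (use e xy in blast)
    then show ?thesis using xy ex by (simp add: H_def generator_closed free_mult_map_generator)
  qed
  have H_zero: "\<zero>\<^bsub>free_square\<^esub> \<in> H"
  proof -
    have "\<zero>\<^bsub>K\<^esub> \<odot>\<^bsub>free_square\<^esub> generator e \<zero>\<^bsub>R\<^esub> \<ominus>\<^bsub>free_square\<^esub> generator e (\<zero>\<^bsub>K\<^esub> \<odot>\<^bsub>R\<^esub> \<zero>\<^bsub>R\<^esub>) \<in> relation_span"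
      by (rule rel_smult) auto
    then show ?thesis using gen[OF M.zero_closed]
      by (simp add: H_def) (simp add: free_mult_map_def free_module_def)
  qed
  have "submodule H K free_square"
  proof (rule F.submoduleI)
    fix g assume g: "g \<in> H"
    then have "\<ominus>\<^bsub>free_square\<^esub> g = (\<ominus>\<^bsub>K\<^esub> \<one>\<^bsub>K\<^esub>) \<odot>\<^bsub>free_square\<^esub> g"
      using F.smult_l_minus[OF R.one_closed, of g] F.smult_one[of g] by (auto simp: H_def)
    then show "\<ominus>\<^bsub>free_square\<^esub> g \<in> H" using H_smult[OF _ g] by simp
  qed (use H_zero H_smult H_add in \<open>auto simp: H_def\<close>)
  then have "f \<in> H"
  proof (rule free_module_spanned_by_support[OF R.cring_axioms _ f])
    fix p assume p: "f p \<noteq> \<zero>\<^bsub>K\<^esub>"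
    then have "fst p \<in> carrier R" "snd p \<in> carrier R" using free_square_support[OF f] by auto
    then have "generator (fst p) (snd p) \<in> H" using p unit[of "fst p" "snd p"] by (intro H_gen) auto
    then show "basis_elt K p \<in> H" by simp
  qed
  then show ?thesis by (simp add: H_def)
qed

text \<open>Surjectivity of the multiplication is \<open>x = e x\<close>. For injectivity, the left factors occurring in a
  given tensor are finitely many, so one local unit \<open>e\<close> serves them all and the tensor is
  \<open>e \<otimes> z\<close> with \<open>z\<close> its product; if \<open>z = 0\<close>, the tensor vanishes. Thus the kernel on the free module is
  precisely the span of the relations.\<close>

theorem idempotent_local_units_imp_firm:
  assumes "idempotent_local_units R"
  shows "firm K R"
proof -
  interpret F: module K free_square by (rule module_free_square)
  let ?\<phi> = "free_mult_map K R"
  obtain E where E: "E \<subseteq> carrier R"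
    "\<forall>X. finite X \<and> X \<subseteq> carrier R \<longrightarrow> (\<exists>e\<in>E. \<forall>b\<in>X. e \<otimes>\<^bsub>R\<^esub> b = b \<and> b \<otimes>\<^bsub>R\<^esub> e = b)"
    using assms unfolding idempotent_local_units_def by (elim exE conjE)
  have onto: "?\<phi> ` carrier free_square = carrier R"
  proof
    show "carrier R \<subseteq> ?\<phi> ` carrier free_square"
    proof
      fix x assume x: "x \<in> carrier R"
      then obtain e where "e \<in> carrier R" "e \<otimes>\<^bsub>R\<^esub> x = x" using E(1) E(2)[rule_format, of "{x}"] by auto
      then show "x \<in> ?\<phi> ` carrier free_square"
        using x free_mult_map_generator[of e x] by (metis generator_closed imageI)
    qed
  qed (use free_mult_map_closed in auto)
  have kernel: "relation_span = {f \<in> carrier free_square. ?\<phi> f = \<zero>\<^bsub>R\<^esub>}" (is "_ = ?Ker")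
  proof
    show "relation_span \<subseteq> ?Ker"
      using tensor_relations_in_kernel submodule_mult_kernel by (rule hull_minimal)
    show "?Ker \<subseteq> relation_span"
    proof
      fix f assume f: "f \<in> ?Ker"
      let ?X = "fst ` {p. f p \<noteq> \<zero>\<^bsub>K\<^esub>}"
      have "finite ?X" "?X \<subseteq> carrier R" using free_square_support[of f] f by auto
      then obtain e where e: "e \<in> carrier R" "\<And>b. b \<in> ?X \<Longrightarrow> e \<otimes>\<^bsub>R\<^esub> b = b"
        using E(1) E(2)[rule_format, of ?X] by blast
      have eq: "f \<ominus>\<^bsub>free_square\<^esub> generator e (?\<phi> f) \<in> relation_span"
        using e f by (intro free_element_as_single_tensor) force+
      have zero: "\<zero>\<^bsub>free_square\<^esub> \<ominus>\<^bsub>free_square\<^esub> generator e \<zero>\<^bsub>R\<^esub> \<in> relation_span"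
        using free_element_as_single_tensor[OF e(1) F.M.zero_closed]
        by (simp add: free_mult_map_def free_module_def)
      note N = F.submoduleE[OF submodule_relation_span]
      have g: "generator e \<zero>\<^bsub>R\<^esub> \<in> carrier free_square" using e(1) by (simp add: generator_closed)
      have "(f \<ominus>\<^bsub>free_square\<^esub> generator e \<zero>\<^bsub>R\<^esub>) \<oplus>\<^bsub>free_square\<^esub>
          \<ominus>\<^bsub>free_square\<^esub> (\<zero>\<^bsub>free_square\<^esub> \<ominus>\<^bsub>free_square\<^esub> generator e \<zero>\<^bsub>R\<^esub>) \<in> relation_span"
        using eq f zero by (intro N(5) N(3)) auto
      then show "f \<in> relation_span"
        using f g by (simp add: F.M.minus_eq F.M.a_assoc F.M.l_neg)
    qed
  qed
  have tensor: "tensor_square K R = quotient_module K free_square relation_span"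
    by (simp add: tensor_square_def Let_def)
  have "mult_map K R \<in> lin_hom K (tensor_square K R) R"
    "bij_betw (mult_map K R) (carrier (tensor_square K R)) (carrier R)"
    unfolding mult_map_def tensor
    by (rule first_isomorphism_quotient_module[OF module_free_square module_axioms
          free_mult_map_closed free_mult_map_add free_mult_map_smult onto kernel]; assumption)+
  then show ?thesis by (simp add: firm_def k_algebra_axioms)
qed

end

section \<open>Directed unions of algebras\<close>

lemma lin_homD:
  assumes "f \<in> lin_hom K X Y"
  shows "x \<in> carrier X \<Longrightarrow> f x \<in> carrier Y"
    and "\<lbrakk>x \<in> carrier X; y \<in> carrier X\<rbrakk> \<Longrightarrow> f (x \<oplus>\<^bsub>X\<^esub> y) = f x \<oplus>\<^bsub>Y\<^esub> f y"
    and "\<lbrakk>c \<in> carrier K; x \<in> carrier X\<rbrakk> \<Longrightarrow> f (c \<odot>\<^bsub>X\<^esub> x) = c \<odot>\<^bsub>Y\<^esub> f x"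
    and "x \<notin> carrier X \<Longrightarrow> f x = undefined"
  using assms by (auto simp: lin_hom_def PiE_def extensional_def)

lemma alg_homD:
  assumes "f \<in> alg_hom K X Y"
  shows "x \<in> carrier X \<Longrightarrow> f x \<in> carrier Y"
    and "\<lbrakk>x \<in> carrier X; y \<in> carrier X\<rbrakk> \<Longrightarrow> f (x \<oplus>\<^bsub>X\<^esub> y) = f x \<oplus>\<^bsub>Y\<^esub> f y"
    and "\<lbrakk>c \<in> carrier K; x \<in> carrier X\<rbrakk> \<Longrightarrow> f (c \<odot>\<^bsub>X\<^esub> x) = c \<odot>\<^bsub>Y\<^esub> f x"
    and "\<lbrakk>x \<in> carrier X; y \<in> carrier X\<rbrakk> \<Longrightarrow> f (x \<otimes>\<^bsub>X\<^esub> y) = f x \<otimes>\<^bsub>Y\<^esub> f y"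
    and "x \<notin> carrier X \<Longrightarrow> f x = undefined"
  using assms lin_homD[of f K X Y] unfolding alg_hom_def by blast+

lemma alg_homI:
  assumes "\<And>x. x \<in> carrier X \<Longrightarrow> f x \<in> carrier Y"
    and "\<And>x y. \<lbrakk>x \<in> carrier X; y \<in> carrier X\<rbrakk> \<Longrightarrow> f (x \<oplus>\<^bsub>X\<^esub> y) = f x \<oplus>\<^bsub>Y\<^esub> f y"
    and "\<And>c x. \<lbrakk>c \<in> carrier K; x \<in> carrier X\<rbrakk> \<Longrightarrow> f (c \<odot>\<^bsub>X\<^esub> x) = c \<odot>\<^bsub>Y\<^esub> f x"
    and "\<And>x y. \<lbrakk>x \<in> carrier X; y \<in> carrier X\<rbrakk> \<Longrightarrow> f (x \<otimes>\<^bsub>X\<^esub> y) = f x \<otimes>\<^bsub>Y\<^esub> f y"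
    and "\<And>x. x \<notin> carrier X \<Longrightarrow> f x = undefined"
  shows "f \<in> alg_hom K X Y"
  using assms by (auto simp: alg_hom_def lin_hom_def PiE_def extensional_def)

lemma (in k_algebra) subalgebra_is_k_algebra:
  assumes "k_subalgebra K S R"
  shows "k_algebra K (R\<lparr>carrier := S\<rparr>)"
proof -
  have sub: "submodule S K R" and mult: "\<And>x y. \<lbrakk>x \<in> S; y \<in> S\<rbrakk> \<Longrightarrow> x \<otimes>\<^bsub>R\<^esub> y \<in> S"
    using assms by (auto simp: k_subalgebra_def)
  have "S \<subseteq> carrier R" by (rule submoduleE(1)[OF sub])
  moreover have "module K (R\<lparr>carrier := S\<rparr>)"
    by (rule submodule.submodule_is_module[OF sub module_axioms])
  ultimately show ?thesis
    by (auto intro!: k_algebra.intro k_algebra_axioms.intro mult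
        simp: m_assoc m_l_distr m_r_distr smult_m_left smult_m_right subsetD)
qed

text \<open>A direct system of algebras embedded compatibly in one algebra \<open>L\<close>. The union of the images
  is then the colimit, because every finite set of its elements already lies in the image of a
  single member of the system.\<close>

locale directed_union_of_algebras =
  L: k_algebra K L
  for K :: "('k, 'z) ring_scheme" and L :: "('k, 'l) module" +
  fixes I :: "'i set" and r :: "'i rel" and T :: "'i \<Rightarrow> ('k, 't) module"
    and \<rho> :: "'i \<Rightarrow> 't \<Rightarrow> 'l" and \<sigma> :: "'i \<Rightarrow> 'i \<Rightarrow> 't \<Rightarrow> 't"
  assumes directed: "directed_poset I r"
    and component_algebra: "i \<in> I \<Longrightarrow> k_algebra K (T i)"
    and inclusion: "i \<in> I \<Longrightarrow> \<rho> i \<in> alg_hom K (T i) L"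
    and inclusion_inj: "i \<in> I \<Longrightarrow> inj_on (\<rho> i) (carrier (T i))"
    and transition: "\<lbrakk>i \<in> I; j \<in> I; (i, j) \<in> r\<rbrakk> \<Longrightarrow> \<sigma> j i \<in> alg_hom K (T i) (T j)"
    and inclusion_transition:
      "\<lbrakk>i \<in> I; j \<in> I; (i, j) \<in> r; t \<in> carrier (T i)\<rbrakk> \<Longrightarrow> \<rho> j (\<sigma> j i t) = \<rho> i t"
begin

definition image_union :: "'l set"
  where "image_union = (\<Union>i\<in>I. \<rho> i ` carrier (T i))"

lemma upper_bound: "\<lbrakk>i \<in> I; j \<in> I\<rbrakk> \<Longrightarrow> \<exists>k\<in>I. (i, k) \<in> r \<and> (j, k) \<in> r"
  using directed by (simp add: directed_poset_def)

lemma image_mono: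
  assumes "i \<in> I" "j \<in> I" "(i, j) \<in> r"
  shows "\<rho> i ` carrier (T i) \<subseteq> \<rho> j ` carrier (T j)"
  using inclusion_transition[OF assms] alg_homD(1)[OF transition[OF assms]] by force

lemma finite_subset_of_union:
  assumes "finite F" "F \<subseteq> image_union"
  shows "\<exists>j\<in>I. F \<subseteq> \<rho> j ` carrier (T j)"
  using assms
proof (induction F rule: finite_induct)
  case empty
  then show ?case using directed by (auto simp: directed_poset_def)
next
  case (insert x F)
  then obtain i j where ij: "i \<in> I" "x \<in> \<rho> i ` carrier (T i)" "j \<in> I" "F \<subseteq> \<rho> j ` carrier (T j)"
    by (auto simp: image_union_def)
  then obtain k where k: "k \<in> I" "(i, k) \<in> r" "(j, k) \<in> r" using upper_bound by blast
  have "x \<in> \<rho> k ` carrier (T k)"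
    using image_mono[OF ij(1) k(1,2)] ij(2) by (rule subsetD)
  moreover have "F \<subseteq> \<rho> k ` carrier (T k)"
    using ij(4) image_mono[OF ij(3) k(1,3)] by (rule subset_trans)
  ultimately have "insert x F \<subseteq> \<rho> k ` carrier (T k)" by simp
  then show ?case using k(1) by blast
qed

text \<open>By directedness two elements of the union lie in one image, which reduces computing with them to
  computing in one \<open>T i\<close>.\<close>

lemma union_induct2:
  assumes "x \<in> image_union" "y \<in> image_union"
    and "\<And>i s t. \<lbrakk>i \<in> I; s \<in> carrier (T i); t \<in> carrier (T i)\<rbrakk> \<Longrightarrow> P (\<rho> i s) (\<rho> i t)"
  shows "P x y"
proof -
  obtain i where "i \<in> I" "{x, y} \<subseteq> \<rho> i ` carrier (T i)"
    using finite_subset_of_union[of "{x, y}"] assms(1,2) by auto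
  then obtain s t where "s \<in> carrier (T i)" "x = \<rho> i s" "t \<in> carrier (T i)" "y = \<rho> i t" by blast
  then show ?thesis using assms(3)[OF \<open>i \<in> I\<close>] by simp
qed

lemma inclusion_in_union: "\<lbrakk>i \<in> I; t \<in> carrier (T i)\<rbrakk> \<Longrightarrow> \<rho> i t \<in> image_union"
  by (auto simp: image_union_def)

lemma union_subset: "image_union \<subseteq> carrier L"
  using alg_homD(1)[OF inclusion] by (auto simp: image_union_def)

lemma union_smult_closed:
  assumes c: "c \<in> carrier K" and x: "x \<in> image_union"
  shows "c \<odot>\<^bsub>L\<^esub> x \<in> image_union"
proof -
  obtain i t where i: "i \<in> I" "t \<in> carrier (T i)" "x = \<rho> i t" using x by (auto simp: image_union_def)
  interpret Ti: k_algebra K "T i" by (rule component_algebra) fact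
  have "c \<odot>\<^bsub>L\<^esub> x = \<rho> i (c \<odot>\<^bsub>T i\<^esub> t)" using alg_homD(3)[OF inclusion] i c by simp
  then show ?thesis using i c by (simp add: inclusion_in_union)
qed

lemma union_is_subalgebra: "k_subalgebra K image_union L"
proof -
  have add: "x \<oplus>\<^bsub>L\<^esub> y \<in> image_union" and mult: "x \<otimes>\<^bsub>L\<^esub> y \<in> image_union"
    if "x \<in> image_union" "y \<in> image_union" for x y
  proof -
    show "x \<oplus>\<^bsub>L\<^esub> y \<in> image_union"
    proof (rule union_induct2[OF that])
      fix i s t assume *: "i \<in> I" "s \<in> carrier (T i)" "t \<in> carrier (T i)"
      interpret Ti: k_algebra K "T i" by (rule component_algebra) fact
      have "\<rho> i s \<oplus>\<^bsub>L\<^esub> \<rho> i t = \<rho> i (s \<oplus>\<^bsub>T i\<^esub> t)" using alg_homD(2)[OF inclusion] * by simp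
      then show "\<rho> i s \<oplus>\<^bsub>L\<^esub> \<rho> i t \<in> image_union" using * by (simp add: inclusion_in_union)
    qed
    show "x \<otimes>\<^bsub>L\<^esub> y \<in> image_union"
    proof (rule union_induct2[OF that])
      fix i s t assume *: "i \<in> I" "s \<in> carrier (T i)" "t \<in> carrier (T i)"
      interpret Ti: k_algebra K "T i" by (rule component_algebra) fact
      have "\<rho> i s \<otimes>\<^bsub>L\<^esub> \<rho> i t = \<rho> i (s \<otimes>\<^bsub>T i\<^esub> t)" using alg_homD(4)[OF inclusion] * by simp
      then show "\<rho> i s \<otimes>\<^bsub>L\<^esub> \<rho> i t \<in> image_union" using * by (simp add: inclusion_in_union Ti.m_closed)
    qed
  qed
  have neg: "\<ominus>\<^bsub>L\<^esub> x \<in> image_union" if x: "x \<in> image_union" for x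
  proof -
    have "(\<ominus>\<^bsub>K\<^esub> \<one>\<^bsub>K\<^esub>) \<odot>\<^bsub>L\<^esub> x \<in> image_union" using x by (intro union_smult_closed) auto
    also have "(\<ominus>\<^bsub>K\<^esub> \<one>\<^bsub>K\<^esub>) \<odot>\<^bsub>L\<^esub> x = \<ominus>\<^bsub>L\<^esub> x"
      using x union_subset L.smult_l_minus[of "\<one>\<^bsub>K\<^esub>" x] by (simp add: subsetD)
    finally show ?thesis .
  qed
  obtain i where i: "i \<in> I" using directed by (auto simp: directed_poset_def)
  interpret Ti: k_algebra K "T i" by (rule component_algebra) fact
  have x: "\<rho> i \<zero>\<^bsub>T i\<^esub> \<in> image_union" using i by (simp add: inclusion_in_union)
  have "\<zero>\<^bsub>K\<^esub> \<odot>\<^bsub>L\<^esub> \<rho> i \<zero>\<^bsub>T i\<^esub> \<in> image_union" using x by (intro union_smult_closed) auto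
  then have "\<zero>\<^bsub>L\<^esub> \<in> image_union" using x union_subset by (simp add: subsetD)
  then show ?thesis
    unfolding k_subalgebra_def
    by (intro conjI ballI L.submoduleI union_subset neg add mult union_smult_closed)
qed

abbreviation image_union_algebra :: "('k, 'l) module"
  where "image_union_algebra \<equiv> L\<lparr>carrier := image_union\<rparr>"

lemma union_algebra_is_k_algebra: "k_algebra K image_union_algebra"
  by (rule L.subalgebra_is_k_algebra) (rule union_is_subalgebra)

lemma inclusion_union: "i \<in> I \<Longrightarrow> \<rho> i \<in> alg_hom K (T i) image_union_algebra"
  using alg_homD[OF inclusion, of i] by (intro alg_homI) (auto simp: inclusion_in_union)

text \<open>The unit of \<open>T i\<close> need not be preserved by the transition maps; its image in \<open>L\<close> is an idempotent
  acting as a unit on the image of \<open>T i\<close>, and these idempotents are the local units.\<close>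

lemma union_idempotent_local_units:
  assumes u: "\<And>i. i \<in> I \<Longrightarrow> u i \<in> carrier (T i)"
    and unit: "\<And>i t. \<lbrakk>i \<in> I; t \<in> carrier (T i)\<rbrakk> \<Longrightarrow> u i \<otimes>\<^bsub>T i\<^esub> t = t \<and> t \<otimes>\<^bsub>T i\<^esub> u i = t"
  shows "idempotent_local_units image_union_algebra"
  unfolding idempotent_local_units_def
proof (intro exI[of _ "(\<lambda>i. \<rho> i (u i)) ` I"] conjI ballI allI impI)
  have act: "\<rho> i (u i) \<otimes>\<^bsub>L\<^esub> \<rho> i t = \<rho> i t \<and> \<rho> i t \<otimes>\<^bsub>L\<^esub> \<rho> i (u i) = \<rho> i t"
    if "i \<in> I" "t \<in> carrier (T i)" for i t
    using alg_homD(4)[OF inclusion[OF that(1)]] u[OF that(1)] unit[OF that] that(2) by metis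
  show "(\<lambda>i. \<rho> i (u i)) ` I \<subseteq> carrier image_union_algebra" using u by (auto simp: inclusion_in_union)
  show "e \<otimes>\<^bsub>image_union_algebra\<^esub> e = e" if "e \<in> (\<lambda>i. \<rho> i (u i)) ` I" for e
    using that act u by auto
  fix F assume "finite F \<and> F \<subseteq> carrier image_union_algebra"
  then obtain j where j: "j \<in> I" "F \<subseteq> \<rho> j ` carrier (T j)"
    using finite_subset_of_union[of F] by auto
  then have "\<forall>b\<in>F. \<rho> j (u j) \<otimes>\<^bsub>L\<^esub> b = b \<and> b \<otimes>\<^bsub>L\<^esub> \<rho> j (u j) = b"
    using act by blast
  then show "\<exists>e\<in>(\<lambda>i. \<rho> i (u i)) ` I. \<forall>b\<in>F.
      e \<otimes>\<^bsub>image_union_algebra\<^esub> b = b \<and> b \<otimes>\<^bsub>image_union_algebra\<^esub> e = b"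
    using j(1) by auto
qed

text \<open>A compatible family \<open>d\<close> forces \<open>h (\<rho> i t) = d i t\<close>. This is consistent: if \<open>\<rho> i s = \<rho> j t\<close>, then \<open>s\<close>
  and \<open>t\<close> become equal in \<open>T k\<close> for any \<open>k\<close> above \<open>i\<close> and \<open>j\<close>, by injectivity of \<open>\<rho> k\<close>, and \<open>d\<close> is compatible
  with the transition maps.\<close>

theorem union_universal:
  assumes d: "\<And>i. i \<in> I \<Longrightarrow> d i \<in> alg_hom K (T i) B"
    and compat: "\<And>i j. \<lbrakk>i \<in> I; j \<in> I; (i, j) \<in> r\<rbrakk>
      \<Longrightarrow> compose (carrier (T i)) (d j) (\<sigma> j i) = d i"
  shows "\<exists>!h. h \<in> alg_hom K image_union_algebra B \<and>
    (\<forall>i\<in>I. compose (carrier (T i)) h (\<rho> i) = d i)"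
proof -
  have dcomp: "d j (\<sigma> j i t) = d i t"
    if "i \<in> I" "j \<in> I" "(i, j) \<in> r" "t \<in> carrier (T i)" for i j t
    using fun_cong[OF compat[OF that(1-3)], of t] that(4) by (simp add: compose_def)
  have indep: "d i s = d j t"
    if "i \<in> I" "j \<in> I" "s \<in> carrier (T i)" "t \<in> carrier (T j)" "\<rho> i s = \<rho> j t" for i j s t
  proof -
    obtain k where k: "k \<in> I" "(i, k) \<in> r" "(j, k) \<in> r" using upper_bound \<open>i \<in> I\<close> \<open>j \<in> I\<close> by blast
    have "\<rho> k (\<sigma> k i s) = \<rho> k (\<sigma> k j t)" using that k by (simp add: inclusion_transition)
    moreover have "\<sigma> k i s \<in> carrier (T k)" "\<sigma> k j t \<in> carrier (T k)"
      using that k by (auto intro: alg_homD(1)[OF transition])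
    ultimately have "\<sigma> k i s = \<sigma> k j t" using inclusion_inj[OF k(1)] by (auto dest: inj_onD)
    then show ?thesis using dcomp[of i k s] dcomp[of j k t] that k by simp
  qed
  define h where "h = (\<lambda>x\<in>image_union. THE y. \<exists>i\<in>I. \<exists>t\<in>carrier (T i). x = \<rho> i t \<and> y = d i t)"
  have h: "h (\<rho> i t) = d i t" if "i \<in> I" "t \<in> carrier (T i)" for i t
  proof -
    have "(THE y. \<exists>j\<in>I. \<exists>s\<in>carrier (T j). \<rho> i t = \<rho> j s \<and> y = d j s) = d i t"
    proof (rule the_equality)
      show "\<exists>j\<in>I. \<exists>s\<in>carrier (T j). \<rho> i t = \<rho> j s \<and> d i t = d j s" using that by blast
      fix y assume "\<exists>j\<in>I. \<exists>s\<in>carrier (T j). \<rho> i t = \<rho> j s \<and> y = d j s"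
      then obtain j s where "j \<in> I" "s \<in> carrier (T j)" "\<rho> i t = \<rho> j s" "y = d j s" by blast
      then show "y = d i t" using indep[of i j t s] that by simp
    qed
    then show ?thesis using that by (simp add: h_def inclusion_in_union)
  qed
  show ?thesis
  proof (rule ex1I[of _ h])
    have "h \<in> alg_hom K image_union_algebra B"
    proof (rule alg_homI)
      fix x assume "x \<in> carrier image_union_algebra"
      then obtain i t where "i \<in> I" "t \<in> carrier (T i)" "x = \<rho> i t" by (auto simp: image_union_def)
      then show "h x \<in> carrier B" using h alg_homD(1)[OF d] by simp
    next
      fix x y assume "x \<in> carrier image_union_algebra" "y \<in> carrier image_union_algebra"
      then have xy: "x \<in> image_union" "y \<in> image_union" by simp_all
      show "h (x \<oplus>\<^bsub>image_union_algebra\<^esub> y) = h x \<oplus>\<^bsub>B\<^esub> h y"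
      proof (rule union_induct2[OF xy])
        fix i s t assume *: "i \<in> I" "s \<in> carrier (T i)" "t \<in> carrier (T i)"
        interpret Ti: k_algebra K "T i" by (rule component_algebra) fact
        have "\<rho> i s \<oplus>\<^bsub>L\<^esub> \<rho> i t = \<rho> i (s \<oplus>\<^bsub>T i\<^esub> t)" using alg_homD(2)[OF inclusion] * by simp
        then show "h (\<rho> i s \<oplus>\<^bsub>image_union_algebra\<^esub> \<rho> i t) = h (\<rho> i s) \<oplus>\<^bsub>B\<^esub> h (\<rho> i t)"
          using * alg_homD(2)[OF d] by (simp add: h)
      qed
      show "h (x \<otimes>\<^bsub>image_union_algebra\<^esub> y) = h x \<otimes>\<^bsub>B\<^esub> h y"
      proof (rule union_induct2[OF xy])
        fix i s t assume *: "i \<in> I" "s \<in> carrier (T i)" "t \<in> carrier (T i)"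
        interpret Ti: k_algebra K "T i" by (rule component_algebra) fact
        have "\<rho> i s \<otimes>\<^bsub>L\<^esub> \<rho> i t = \<rho> i (s \<otimes>\<^bsub>T i\<^esub> t)" using alg_homD(4)[OF inclusion] * by simp
        then show "h (\<rho> i s \<otimes>\<^bsub>image_union_algebra\<^esub> \<rho> i t) = h (\<rho> i s) \<otimes>\<^bsub>B\<^esub> h (\<rho> i t)"
          using * alg_homD(4)[OF d] by (simp add: h Ti.m_closed)
      qed
    next
      fix c x assume c: "c \<in> carrier K" and "x \<in> carrier image_union_algebra"
      then obtain i t where i: "i \<in> I" "t \<in> carrier (T i)" "x = \<rho> i t" by (auto simp: image_union_def)
      interpret Ti: k_algebra K "T i" by (rule component_algebra) fact
      have "c \<odot>\<^bsub>L\<^esub> x = \<rho> i (c \<odot>\<^bsub>T i\<^esub> t)" using alg_homD(3)[OF inclusion] i c by simp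
      then show "h (c \<odot>\<^bsub>image_union_algebra\<^esub> x) = c \<odot>\<^bsub>B\<^esub> h x"
        using i c alg_homD(3)[OF d] by (simp add: h)
    qed (simp add: h_def)
    moreover have "compose (carrier (T i)) h (\<rho> i) = d i" if "i \<in> I" for i
      using that h alg_homD(5)[OF d] by (auto simp: compose_def restrict_def fun_eq_iff)
    ultimately show "h \<in> alg_hom K image_union_algebra B \<and>
        (\<forall>i\<in>I. compose (carrier (T i)) h (\<rho> i) = d i)" by blast
  next
    fix g assume g: "g \<in> alg_hom K image_union_algebra B \<and>
      (\<forall>i\<in>I. compose (carrier (T i)) g (\<rho> i) = d i)"
    show "g = h"
    proof
      fix x
      show "g x = h x"
      proof (cases "x \<in> image_union")
        case True
        then obtain i t where i: "i \<in> I" "t \<in> carrier (T i)" "x = \<rho> i t" by (auto simp: image_union_def)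
        then have "g x = d i t" using g by (metis compose_eq)
        then show ?thesis using i h by simp
      next
        case False
        then show ?thesis using g alg_homD(5)[of g K image_union_algebra B x] by (simp add: h_def)
      qed
    qed
  qed
qed

end

section \<open>Endomorphism algebras and split monomorphisms\<close>

context linear_category
begin

lemma End_alg_simps [simp]:
  "carrier (End_alg C X) = Hom C X X"
  "x \<otimes>\<^bsub>End_alg C X\<^esub> y = Comp C X X X x y"
  "x \<oplus>\<^bsub>End_alg C X\<^esub> y = hom_add C X X x y"
  "c \<odot>\<^bsub>End_alg C X\<^esub> x = hom_smult C X X c x"
  by (simp_all add: End_alg_def)

lemma Hom_add_closed:
  assumes "X \<in> Obj C" "Y \<in> Obj C" "f \<in> Hom C X Y" "g \<in> Hom C X Y"
  shows "hom_add C X Y f g \<in> Hom C X Y"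
proof -
  interpret H: module K "hom_module C X Y" using assms(1,2) by (rule module_Hom)
  show ?thesis using H.M.a_closed[of f g] assms by (simp add: hom_module_def)
qed

lemma Hom_smult_closed:
  assumes "X \<in> Obj C" "Y \<in> Obj C" "c \<in> carrier K" "f \<in> Hom C X Y"
  shows "hom_smult C X Y c f \<in> Hom C X Y"
proof -
  interpret H: module K "hom_module C X Y" using assms(1,2) by (rule module_Hom)
  show ?thesis using H.smult_closed[of c f] assms by (simp add: hom_module_def)
qed

lemma End_alg_is_k_algebra:
  assumes X: "X \<in> Obj C"
  shows "k_algebra K (End_alg C X)"
proof -
  have "module K (End_alg C X)"
    using module_Hom[OF X X]
    unfolding module_def abelian_group_def abelian_monoid_def abelian_group_axioms_def
      module_axioms_def
    by (simp add: hom_module_def End_alg_def)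
  then show ?thesis
    by (rule k_algebra.intro, intro k_algebra_axioms.intro)
      (simp_all add: X Comp_in_Hom Comp_assoc Comp_add_left Comp_add_right
        Comp_smult_left Comp_smult_right)
qed

lemma End_alg_firm:
  assumes X: "X \<in> Obj C"
  shows "firm K (End_alg C X)"
proof (rule k_algebra.idempotent_local_units_imp_firm[OF End_alg_is_k_algebra[OF X]])
  show "idempotent_local_units (End_alg C X)"
    unfolding idempotent_local_units_def
    by (rule exI[of _ "{Ident C X}"])
      (auto simp: X Ident_in_Hom Comp_Ident_left Comp_Ident_right subset_iff)
qed

lemma conj_map_apply:
  "t \<in> Hom C X X \<Longrightarrow> conj_map C X Y \<mu> \<nu> t = Comp C Y X Y \<mu> (Comp C Y X X t \<nu>)"
  by (simp add: conj_map_def)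

lemma split_cancel:
  assumes "W \<in> Obj C" "X \<in> Obj C" "Y \<in> Obj C" "\<mu> \<in> Hom C X Y" "\<nu> \<in> Hom C Y X"
    and "Comp C X Y X \<nu> \<mu> = Ident C X" and "f \<in> Hom C W X"
  shows "Comp C W Y X \<nu> (Comp C W X Y \<mu> f) = f"
  using assms Comp_assoc[of W X Y X f \<mu> \<nu>] by (simp add: Comp_Ident_left)

text \<open>Multiplicativity is where the splitting enters:
  \<open>(\<mu> s \<nu>) (\<mu> t \<nu>) = \<mu> s (\<nu> \<mu>) t \<nu> = \<mu> (s t) \<nu>\<close>. The identity is sent to the idempotent \<open>\<mu> \<nu>\<close>, which
  in general is not the identity.\<close>

lemma conj_map_alg_hom:
  assumes obj: "X \<in> Obj C" "Y \<in> Obj C" and hom: "\<mu> \<in> Hom C X Y" "\<nu> \<in> Hom C Y X"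
    and split: "Comp C X Y X \<nu> \<mu> = Ident C X"
  shows "conj_map C X Y \<mu> \<nu> \<in> alg_hom K (End_alg C X) (End_alg C Y)"
proof (rule alg_homI; simp)
  fix s t assume st: "s \<in> Hom C X X" "t \<in> Hom C X X"
  show "conj_map C X Y \<mu> \<nu> s \<in> Hom C Y Y"
    using st obj hom by (simp add: conj_map_apply Comp_in_Hom)
  show "conj_map C X Y \<mu> \<nu> (hom_add C X X s t) =
      hom_add C Y Y (conj_map C X Y \<mu> \<nu> s) (conj_map C X Y \<mu> \<nu> t)"
    using st obj hom by (simp add: conj_map_apply Comp_in_Hom Hom_add_closed Comp_add_left Comp_add_right)
  show "conj_map C X Y \<mu> \<nu> (Comp C X X X s t) =
      Comp C Y Y Y (conj_map C X Y \<mu> \<nu> s) (conj_map C X Y \<mu> \<nu> t)"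
    using st obj hom
    by (simp add: conj_map_apply Comp_in_Hom Comp_assoc split_cancel[OF _ obj hom split])
next
  fix c t assume "c \<in> carrier K" "t \<in> Hom C X X"
  then show "conj_map C X Y \<mu> \<nu> (hom_smult C X X c t) =
      hom_smult C Y Y c (conj_map C X Y \<mu> \<nu> t)"
    using obj hom by (simp add: conj_map_apply Comp_in_Hom Hom_smult_closed Comp_smult_left Comp_smult_right)
qed (simp add: conj_map_def)

lemma conj_map_retraction:
  assumes obj: "X \<in> Obj C" "Y \<in> Obj C" and hom: "\<mu> \<in> Hom C X Y" "\<nu> \<in> Hom C Y X"
    and split: "Comp C X Y X \<nu> \<mu> = Ident C X" and t: "t \<in> Hom C X X"
  shows "Comp C X Y X \<nu> (Comp C X Y Y (conj_map C X Y \<mu> \<nu> t) \<mu>) = t"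
  using obj hom t
  by (simp add: conj_map_apply Comp_in_Hom Comp_assoc split Comp_Ident_right
      split_cancel[OF _ obj hom split])

lemma conj_map_inj:
  assumes "X \<in> Obj C" "Y \<in> Obj C" "\<mu> \<in> Hom C X Y" "\<nu> \<in> Hom C Y X"
    and "Comp C X Y X \<nu> \<mu> = Ident C X"
  shows "inj_on (conj_map C X Y \<mu> \<nu>) (Hom C X X)"
  using conj_map_retraction[OF assms] by (metis inj_onI)

lemma conj_map_comp:
  assumes obj: "X \<in> Obj C" "Y \<in> Obj C" "Z \<in> Obj C"
    and hom: "\<mu> \<in> Hom C X Y" "\<nu> \<in> Hom C Y X" "\<mu>' \<in> Hom C Y Z" "\<nu>' \<in> Hom C Z Y"
  shows "compose (Hom C X X) (conj_map C Y Z \<mu>' \<nu>') (conj_map C X Y \<mu> \<nu>) =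
    conj_map C X Z (Comp C X Y Z \<mu>' \<mu>) (Comp C Z Y X \<nu> \<nu>')"
proof
  fix t
  show "compose (Hom C X X) (conj_map C Y Z \<mu>' \<nu>') (conj_map C X Y \<mu> \<nu>) t =
      conj_map C X Z (Comp C X Y Z \<mu>' \<mu>) (Comp C Z Y X \<nu> \<nu>') t"
  proof (cases "t \<in> Hom C X X")
    case True
    then show ?thesis using obj hom
      by (simp add: compose_def conj_map_apply Comp_in_Hom Comp_assoc)
  qed (simp add: compose_def conj_map_def)
qed

text \<open>Conjugation identifies \<open>End(X)\<close> with the corner \<open>e End(Y) e\<close> of the idempotent \<open>e = \<mu> \<nu>\<close>: an element
  \<open>t = e t e\<close> of the corner is the conjugate of \<open>\<nu> t \<mu>\<close>.\<close>

lemma conj_map_image: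
  assumes obj: "X \<in> Obj C" "Y \<in> Obj C" and hom: "\<mu> \<in> Hom C X Y" "\<nu> \<in> Hom C Y X"
    and split: "Comp C X Y X \<nu> \<mu> = Ident C X"
  defines "e \<equiv> Comp C Y X Y \<mu> \<nu>"
  shows "conj_map C X Y \<mu> \<nu> ` Hom C X X =
    {t \<in> Hom C Y Y. t = Comp C Y Y Y e (Comp C Y Y Y t e)}"
proof (intro equalityI subsetI)
  fix t assume "t \<in> conj_map C X Y \<mu> \<nu> ` Hom C X X"
  then obtain s where s: "s \<in> Hom C X X" "t = conj_map C X Y \<mu> \<nu> s" by blast
  then show "t \<in> {t \<in> Hom C Y Y. t = Comp C Y Y Y e (Comp C Y Y Y t e)}"
    using obj hom unfolding e_def
    by (simp add: conj_map_apply Comp_in_Hom Comp_assoc split_cancel[OF _ obj hom split])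
next
  fix t assume "t \<in> {t \<in> Hom C Y Y. t = Comp C Y Y Y e (Comp C Y Y Y t e)}"
  then have t: "t \<in> Hom C Y Y" "t = Comp C Y Y Y e (Comp C Y Y Y t e)" by simp_all
  let ?s = "Comp C X Y X \<nu> (Comp C X Y Y t \<mu>)"
  have s: "?s \<in> Hom C X X" using t(1) obj hom by (simp add: Comp_in_Hom)
  have "conj_map C X Y \<mu> \<nu> ?s = Comp C Y Y Y e (Comp C Y Y Y t e)"
    using t(1) s obj hom unfolding e_def by (simp add: conj_map_apply Comp_in_Hom Comp_assoc)
  then show "t \<in> conj_map C X Y \<mu> \<nu> ` Hom C X X" using s t(2) by (metis imageI)
qed

end

section \<open>Split direct systems\<close>

locale split_direct_system = linear_category K C
  for K :: "('k, 'z) ring_scheme" and C :: "('k, 'o, 'm) lin_category" +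
  fixes I :: "'i set" and r :: "'i rel"
    and Ms :: "('i, 'i \<times> 'i, 'o, 'm \<times> 'm) functor_data"
  assumes directed: "directed_poset I r"
    and split_functor: "is_functor (poset_cat I r) (split_cat C) Ms"
begin

lemma object: "i \<in> I \<Longrightarrow> ob_map Ms i \<in> Obj C"
  using split_functor by (simp add: is_functor_def poset_cat_def split_cat_def)

lemma order_refl: "i \<in> I \<Longrightarrow> (i, i) \<in> r"
  using directed by (simp add: directed_poset_def partial_order_on_def preorder_on_def refl_on_def)

lemma order_trans: "\<lbrakk>(i, j) \<in> r; (j, k) \<in> r\<rbrakk> \<Longrightarrow> (i, k) \<in> r"
  using directed unfolding directed_poset_def partial_order_on_def preorder_on_def
  by (meson transD)

lemma arrow:
  assumes "i \<in> I" "j \<in> I" "(i, j) \<in> r"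
  shows "sys_mu Ms j i \<in> Hom C (ob_map Ms i) (ob_map Ms j)"
    and "sys_nu Ms i j \<in> Hom C (ob_map Ms j) (ob_map Ms i)"
    and "Comp C (ob_map Ms i) (ob_map Ms j) (ob_map Ms i) (sys_nu Ms i j) (sys_mu Ms j i) =
      Ident C (ob_map Ms i)"
proof -
  have "ar_map Ms i j (i, j) \<in> Hom (split_cat C) (ob_map Ms i) (ob_map Ms j)"
    using split_functor assms by (simp add: is_functor_def poset_cat_def)
  then show "sys_mu Ms j i \<in> Hom C (ob_map Ms i) (ob_map Ms j)"
    and "sys_nu Ms i j \<in> Hom C (ob_map Ms j) (ob_map Ms i)"
    and "Comp C (ob_map Ms i) (ob_map Ms j) (ob_map Ms i) (sys_nu Ms i j) (sys_mu Ms j i) =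
      Ident C (ob_map Ms i)"
    by (auto simp: split_cat_def sys_mu_def sys_nu_def)
qed

lemma arrow_ident:
  assumes "i \<in> I"
  shows "sys_mu Ms i i = Ident C (ob_map Ms i)" "sys_nu Ms i i = Ident C (ob_map Ms i)"
proof -
  have "ar_map Ms i i (i, i) = (Ident C (ob_map Ms i), Ident C (ob_map Ms i))"
    using split_functor assms by (simp add: is_functor_def poset_cat_def split_cat_def)
  then show "sys_mu Ms i i = Ident C (ob_map Ms i)" "sys_nu Ms i i = Ident C (ob_map Ms i)"
    by (simp_all add: sys_mu_def sys_nu_def)
qed

lemma arrow_comp:
  assumes "i \<in> I" "j \<in> I" "k \<in> I" "(i, j) \<in> r" "(j, k) \<in> r"
  shows "sys_mu Ms k i =
      Comp C (ob_map Ms i) (ob_map Ms j) (ob_map Ms k) (sys_mu Ms k j) (sys_mu Ms j i)"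
    and "sys_nu Ms i k =
      Comp C (ob_map Ms k) (ob_map Ms j) (ob_map Ms i) (sys_nu Ms i j) (sys_nu Ms j k)"
proof -
  have "\<forall>i\<in>I. \<forall>j\<in>I. \<forall>k\<in>I. \<forall>a\<in>{(i, j)} \<inter> r. \<forall>b\<in>{(j, k)} \<inter> r.
      ar_map Ms i k (i, k) =
      Comp (split_cat C) (ob_map Ms i) (ob_map Ms j) (ob_map Ms k) (ar_map Ms j k b) (ar_map Ms i j a)"
    using split_functor by (simp add: is_functor_def poset_cat_def)
  then have "ar_map Ms i k (i, k) =
      Comp (split_cat C) (ob_map Ms i) (ob_map Ms j) (ob_map Ms k)
        (ar_map Ms j k (j, k)) (ar_map Ms i j (i, j))"
    using assms by blast
  then show "sys_mu Ms k i =
      Comp C (ob_map Ms i) (ob_map Ms j) (ob_map Ms k) (sys_mu Ms k j) (sys_mu Ms j i)"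
    and "sys_nu Ms i k =
      Comp C (ob_map Ms k) (ob_map Ms j) (ob_map Ms i) (sys_nu Ms i j) (sys_nu Ms j k)"
    by (simp_all add: split_cat_def sys_mu_def sys_nu_def)
qed

abbreviation transition_map :: "'i \<Rightarrow> 'i \<Rightarrow> 'm \<Rightarrow> 'm"
  where "transition_map j i \<equiv>
    conj_map C (ob_map Ms i) (ob_map Ms j) (sys_mu Ms j i) (sys_nu Ms i j)"

lemma transition_map_alg_hom:
  "\<lbrakk>i \<in> I; j \<in> I; (i, j) \<in> r\<rbrakk> \<Longrightarrow>
    transition_map j i \<in> alg_hom K (End_alg C (ob_map Ms i)) (End_alg C (ob_map Ms j))"
  by (intro conj_map_alg_hom object arrow)

lemma End_system_functor: "is_functor (poset_cat I r) (firm_cat K) (End_system C Ms)"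
proof -
  have ident: "transition_map i i = (\<lambda>t\<in>Hom C (ob_map Ms i) (ob_map Ms i). t)" if "i \<in> I" for i
    using that object[OF that]
    by (auto simp: conj_map_def arrow_ident Comp_Ident_left Comp_Ident_right fun_eq_iff)
  have comp: "transition_map k i =
      compose (Hom C (ob_map Ms i) (ob_map Ms i)) (transition_map k j) (transition_map j i)"
    if "i \<in> I" "j \<in> I" "k \<in> I" "(i, j) \<in> r" "(j, k) \<in> r" for i j k
    using conj_map_comp[OF object[OF that(1)] object[OF that(2)] object[OF that(3)]
        arrow(1,2)[OF that(1,2,4)] arrow(1,2)[OF that(2,3,5)]]
    by (simp add: arrow_comp[OF that])
  show ?thesis
    unfolding is_functor_def
  proof (intro conjI ballI)
    fix i j k a b
    assume "i \<in> Obj (poset_cat I r)" "j \<in> Obj (poset_cat I r)" "k \<in> Obj (poset_cat I r)"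
      "a \<in> Hom (poset_cat I r) i j" "b \<in> Hom (poset_cat I r) j k"
    then show "ar_map (End_system C Ms) i k (Comp (poset_cat I r) i j k b a) =
        Comp (firm_cat K) (ob_map (End_system C Ms) i) (ob_map (End_system C Ms) j)
          (ob_map (End_system C Ms) k) (ar_map (End_system C Ms) j k b)
          (ar_map (End_system C Ms) i j a)"
      using comp[of i j k] by (auto simp: poset_cat_def firm_cat_def End_system_def)
  qed (auto simp: poset_cat_def firm_cat_def End_system_def End_alg_firm object
      transition_map_alg_hom ident)
qed

end

theorem proposition5p2:
  fixes K :: "'k ring" and C :: "('k, 'o, 'm) lin_category"
    and I :: "'i set" and r :: "'i rel"
    and Ms :: "('i, 'i \<times> 'i, 'o, 'm \<times> 'm) functor_data"
    and M :: 'o and \<mu> \<nu> :: "'i \<Rightarrow> 'm"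
    and A :: "('k, 'a) module" and \<omega> :: "('o, 'm, ('a, 'v) module, 'v \<Rightarrow> 'v) functor_data"
  assumes "cring K"
    and "linear_category K C"
    and "directed_poset I r"
    and "is_functor (poset_cat I r) (split_cat C) Ms"
    and "is_colimit (poset_cat I r) C (underlying_system Ms) M \<mu>"
    and "\<forall>i\<in>I. \<nu> i \<in> Hom C M (ob_map Ms i) \<and>
           Comp C (ob_map Ms i) M (ob_map Ms i) (\<nu> i) (\<mu> i) = Ident C (ob_map Ms i)"
    and "\<forall>i\<in>I. \<forall>j\<in>I. (i, j) \<in> r \<longrightarrow>
           \<nu> i = Comp C M (ob_map Ms j) (ob_map Ms i) (sys_nu Ms i j) (\<nu> j)"
    and "unital_k_algebra K A"
    and "is_functor C (right_module_cat A) \<omega>"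
    and "\<forall>J :: ('x, 'y) category. category J \<longrightarrow>
           preserves_colimits_of_shape J C (right_module_cat A) \<omega>"
    and "\<forall>i\<in>I. finitely_generated A (ob_map \<omega> (ob_map Ms i)) \<and>
           projective A (ob_map \<omega> (ob_map Ms i))"
  shows "k_subalgebra K (T_dagger C I (ob_map Ms) M \<mu> \<nu>) (End_alg C M)
    \<and> idempotent_local_units (T_dagger_alg C I (ob_map Ms) M \<mu> \<nu>)
    \<and> firm K (T_dagger_alg C I (ob_map Ms) M \<mu> \<nu>)
    \<and> is_colimit (poset_cat I r) (firm_cat K) (End_system C Ms)
        (T_dagger_alg C I (ob_map Ms) M \<mu> \<nu>)
        (\<lambda>i. conj_map C (ob_map Ms i) M (\<mu> i) (\<nu> i))
    \<and> firm_universal TYPE('u) K (poset_cat I r) (End_system C Ms)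
        (T_dagger_alg C I (ob_map Ms) M \<mu> \<nu>)
        (\<lambda>i. conj_map C (ob_map Ms i) M (\<mu> i) (\<nu> i))"
proof -
  interpret split_direct_system K C I r Ms
    using assms(2-4) by (intro split_direct_system.intro split_direct_system_axioms.intro)
  have cocone: "is_cocone (poset_cat I r) C (underlying_system Ms) M \<mu>"
    using assms(5) by (simp add: is_colimit_def)
  have M: "M \<in> Obj C" using cocone by (simp add: is_cocone_def)
  have mu: "\<mu> i \<in> Hom C (ob_map Ms i) M" if "i \<in> I" for i
    using cocone that by (simp add: is_cocone_def poset_cat_def underlying_system_def)
  have mu_comp: "Comp C (ob_map Ms i) (ob_map Ms j) M (\<mu> j) (sys_mu Ms j i) = \<mu> i"
    if "i \<in> I" "j \<in> I" "(i, j) \<in> r" for i j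
    using cocone that
    by (simp add: is_cocone_def poset_cat_def underlying_system_def sys_mu_def)
  have nu: "\<nu> i \<in> Hom C M (ob_map Ms i)" if "i \<in> I" for i using assms(6) that by blast
  have split: "Comp C (ob_map Ms i) M (ob_map Ms i) (\<nu> i) (\<mu> i) = Ident C (ob_map Ms i)"
    if "i \<in> I" for i using assms(6) that by blast
  have nu_comp: "Comp C M (ob_map Ms j) (ob_map Ms i) (sys_nu Ms i j) (\<nu> j) = \<nu> i"
    if "i \<in> I" "j \<in> I" "(i, j) \<in> r" for i j using assms(7) that by simp
  let ?T = "\<lambda>i. End_alg C (ob_map Ms i)"
  let ?\<rho> = "\<lambda>i. conj_map C (ob_map Ms i) M (\<mu> i) (\<nu> i)"
  have \<rho>_comp: "compose (Hom C (ob_map Ms i) (ob_map Ms i)) (?\<rho> j) (transition_map j i) = ?\<rho> i"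
    if "i \<in> I" "j \<in> I" "(i, j) \<in> r" for i j
    using conj_map_comp[OF object[OF that(1)] object[OF that(2)] M arrow(1,2)[OF that]
        mu[OF that(2)] nu[OF that(2)]]
    by (simp add: mu_comp[OF that] nu_comp[OF that])
  interpret D: directed_union_of_algebras K "End_alg C M" I r ?T ?\<rho> transition_map
  proof (intro directed_union_of_algebras.intro directed_union_of_algebras_axioms.intro)
    show "k_algebra K (End_alg C M)" using M by (rule End_alg_is_k_algebra)
    show "?\<rho> j (transition_map j i t) = ?\<rho> i t"
      if "i \<in> I" "j \<in> I" "(i, j) \<in> r" "t \<in> carrier (?T i)" for i j t
      using fun_cong[OF \<rho>_comp[OF that(1-3)], of t] that(4) by (simp add: compose_def)
  qed (use M in \<open>auto intro!: directed End_alg_is_k_algebra object conj_map_alg_hom conj_map_inj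
        mu nu split transition_map_alg_hom\<close>)
  have dagger: "T_dagger C I (ob_map Ms) M \<mu> \<nu> = D.image_union"
  proof -
    have "D.image_union = (\<Union>i\<in>I. {t \<in> Hom C M M. t = Comp C M M M
        (Comp C M (ob_map Ms i) M (\<mu> i) (\<nu> i))
        (Comp C M M M t (Comp C M (ob_map Ms i) M (\<mu> i) (\<nu> i)))})"
      unfolding D.image_union_def End_alg_simps
      by (intro SUP_cong refl conj_map_image object M mu nu split)
    then show ?thesis by (auto simp: T_dagger_def Let_def)
  qed
  have dagger_alg: "T_dagger_alg C I (ob_map Ms) M \<mu> \<nu> = D.image_union_algebra"
    by (simp add: T_dagger_alg_def dagger)
  have sub: "k_subalgebra K D.image_union (End_alg C M)" by (rule D.union_is_subalgebra)
  have units: "idempotent_local_units D.image_union_algebra"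
    by (rule D.union_idempotent_local_units[of "\<lambda>i. Ident C (ob_map Ms i)"])
      (simp_all add: object Ident_in_Hom Comp_Ident_left Comp_Ident_right)
  have firm: "firm K D.image_union_algebra"
    using D.union_algebra_is_k_algebra units by (rule k_algebra.idempotent_local_units_imp_firm)
  have univ: "\<exists>!h. h \<in> alg_hom K D.image_union_algebra B \<and>
      (\<forall>i\<in>I. compose (Hom C (ob_map Ms i) (ob_map Ms i)) h (?\<rho> i) = d i)"
    if "\<forall>i\<in>I. d i \<in> alg_hom K (?T i) B"
      "\<forall>i\<in>I. \<forall>j\<in>I. \<forall>a\<in>{(i, j)} \<inter> r.
        compose (Hom C (ob_map Ms i) (ob_map Ms i)) (d j) (transition_map j i) = d i"
    for B :: "('k, 'w) module" and d
    using D.union_universal[of d B] that by simp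
  have colim: "is_colimit (poset_cat I r) (firm_cat K) (End_system C Ms) D.image_union_algebra ?\<rho>"
    unfolding is_colimit_def
  proof (intro conjI allI impI)
    show "is_functor (poset_cat I r) (firm_cat K) (End_system C Ms)" by (rule End_system_functor)
    show "is_cocone (poset_cat I r) (firm_cat K) (End_system C Ms) D.image_union_algebra ?\<rho>"
      by (auto simp: is_cocone_def poset_cat_def firm_cat_def End_system_def firm
          D.inclusion_union \<rho>_comp)
  next
    fix B d assume "is_cocone (poset_cat I r) (firm_cat K) (End_system C Ms) B d"
    then show "\<exists>!h. h \<in> Hom (firm_cat K) D.image_union_algebra B \<and>
      (\<forall>i\<in>Obj (poset_cat I r). Comp (firm_cat K) (ob_map (End_system C Ms) i)
         D.image_union_algebra B h (?\<rho> i) = d i)"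
      using univ[of d B] by (simp add: is_cocone_def poset_cat_def firm_cat_def End_system_def)
  qed
  have "firm_universal TYPE('u) K (poset_cat I r) (End_system C Ms) D.image_union_algebra ?\<rho>"
    unfolding firm_universal_def
  proof (intro allI impI, elim conjE)
    fix B :: "('k, 'u) module" and d
    assume "\<forall>i\<in>Obj (poset_cat I r). d i \<in> alg_hom K (ob_map (End_system C Ms) i) B"
      and "\<forall>i\<in>Obj (poset_cat I r). \<forall>j\<in>Obj (poset_cat I r). \<forall>a\<in>Hom (poset_cat I r) i j.
        compose (carrier (ob_map (End_system C Ms) i)) (d j) (ar_map (End_system C Ms) i j a) = d i"
    then show "\<exists>!h. h \<in> alg_hom K D.image_union_algebra B \<and>
      (\<forall>i\<in>Obj (poset_cat I r). compose (carrier (ob_map (End_system C Ms) i)) h (?\<rho> i) = d i)"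
      using univ[of d B] by (simp add: poset_cat_def End_system_def)
  qed
  then show ?thesis using sub units firm colim by (simp add: dagger dagger_alg)
qed

end
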